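(* Consider the joint mixed-integer convex program $$\text{(JMICP)}\quad \min\{c^\top x+h^\top y:\ Tx+Wy=q,\ g_i(x,y)\le0\ \forall i\in\mathcal I,\ x\in\mathcal X\cap\{0,1\}^{l_1},\ y\in\mathcal Y\cap(\mathbb Z^{l_2}\times\mathbb R^{l_3})\},$$ and suppose the assumptions of the context hold. Then the decomposition cutting-plane algorithm (Algorithm 3, described in the context) terminates in a finite number of iterations. When it terminates, it either returns an optimal solution to (JMICP) or detects infeasibility.
   Context: Setting: $\mathcal X\subset\mathbb R^{l_1}$, $\mathcal Y\subset\mathbb R^{l_2+l_3}$ are bounded polyhedra, the $g_i$ ($i\in\mathcal I$) are convex functions on $\mathbb R^{l_1+l_2+l_3}$, not necessarily differentiable. Assumptions. (i) $\partial g_i(x_0,y_0)=\partial_xg_i(x_0,y_0)\times\partial_yg_i(x_0,y_0)$ for all $i$ and all $(x_0,y_0)$, where $\partial_xg_i(x_0,y_0)$ is the set of subgradients of $g_i(\cdot,y_0)$ at $x_0$ and $\partial_yg_i$ is analogous. (ii) For any $\hat x\in\mathcal X\cap\{0,1\}^{l_1}$ and any $\hat z\in\mathbb Z^{l_2}$, the set $\{y\in\mathbb R^{l_2+l_3}: T\hat x+Wy=q,\ g_i(\hat x,y)\le0\ \forall i\in\mathcal I,\ y\in\mathcal Y,\ y_j=\hat z_j\ \forall j\in[l_2]\}$ either is empty or has non-empty relative interior. (iii) Every constraint function of every optimization problem occurring belongs to a collection $\mathcal F$ of convex functions, each with domain $\mathbb R^k$ for some $1\le k\le n$, that is closed under fixing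 some of the variables to constants; an oracle solves to optimality, or detects infeasibility of, any convex optimization problem generated by a finite subset of $\mathcal F$; an oracle generates a subgradient of any $f\in\mathcal F$ at any point and the normal cone, at any point, of any closed convex set generated by a finite subset of $\mathcal F$. Second-stage problem at $x^m\in\mathcal X\cap\{0,1\}^{l_1}$: $\min\{h^\top y: Tx^m+Wy=q,\ g_i(x^m,y)\le0\ \forall i\in\mathcal I,\ y\in\mathcal Y\cap(\mathbb Z^{l_2}\times\mathbb R^{l_3})\}$. Algorithm 2 is a pure cutting-plane method for the second-stage problem. At its iteration $n$ it (1) solves a mixed-integer linear master problem ($T x^m+Wy=q$, $y\in\mathcal Y\cap(\mathbb Z^{l_2}\times\mathbb R^{l_3})$, and previously added cuts in $(x,y)$ evaluated at $x=x^m$) with a parametric pure cutting-plane oracle, whose cuts are valid for all $(x,y)$, $x\in\{0,1\}^{l_1}$, $y\in\mathbb Z^{l_2}\times\mathbb R^{l_3}$, satisfying the master constraints; it claims infeasibility if the master is infeasible, and otherwise obtains a master solution $y^{(n)}$, which it returns if $(x^m,y^{(n)})\in\mathcal S=\{(x,y): g_i(x,y)\le0\ \forall i,\ y\in\mathcal Y\}$; (2) adds the cut given by the hyperplane through the Euclidean projection of $(x^m,y^{(n)})$ onto $\mathcal S$, normal to the projection direction; (3) solves the convex program obtained from the second-stage problem by fixing the integer components of $y$ to those of $y^{(n)}$ (and relaxing integrality); if it is feasible, it returns its optimal solution if its value equals the master value, and otherwise, if the optimal solution $\hat y$ satisfies $(x^m,\hat y)\in\mathrm{bd}(\mathcal S)$,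 adds a cut $d_x^\top(x-x^m)+d_y^\top(y-\hat y)\le0$ with $(d_x,d_y)$ in the normal cone of $\{(x,y):g_i(x,y)\le0\ \forall i\}$ at $(x^m,\hat y)$ and with $d_y$ in the normal cone of $\{y: g_i(x^m,y)\le0\ \forall i\}$ at $\hat y$ chosen so that replacing the constraints $g_i(x^m,y)\le 0$ by $d_y^\top(y-\hat y)\le0$ does not change the optimal value of the integer-fixed program. If the second-stage problem is feasible, upon termination a linear program $\min\{h^\top y: Tx^m+Wy=q,\ C^mx^m+D^my\le F^m,\ y\in\mathbb R^{l_2+l_3}\}$ is established that has an optimal solution in common with the second-stage problem and for which $C^mx+D^my\le F^m$ is valid for the feasible set of (JMICP). Benders' cut: with $\mu^m$ and $\lambda^m\ge0$ optimal dual vectors of the equality and inequality constraints of that linear program (so $W^\top\mu^m-(D^m)^\top\lambda^m=h$), it is $\eta\ge a^{m\top}x+b^m$, where $a^m=(\lambda^{m\top}C^m-\mu^{m\top}T)^\top$, $b^m=-(\lambda^{m\top}F^m-\mu^{m\top}q)$. Feasibility cut at $x^m$: $\sum_{j:x^m_j=0}x_j+\sum_{j:x^m_j=1}(1-x_j)\ge1$. Algorithm 3. Set $m=1$, $L=-\infty$, $U=+\infty$. While $L<U$: solve, with a pure cutting-plane oracle for mixed-integer linear programs, the first-stage problem of minimizing $c^\top x+\eta$ over $x\in\mathcal X\cap\{0,1\}^{l_1}$ and $\eta$ subject to all Benders' and feasibility cuts added so far, and get the optimal solution $x^m$; if it is infeasible, stop and claim that (JMICP) is infeasible. Set $L$ to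 its optimal value. Apply Algorithm 2 to the second-stage problem at $x^m$; let $y^m$ be an optimal solution of it, and set $U$ to $c^\top x^m$ plus its optimal value. If Algorithm 2 returns an optimal solution, add the Benders' cut to the first-stage problem; else (infeasibility detected) add the feasibility cut. Set $m\leftarrow m+1$. When the loop ends, return the last computed $(x^m,y^m)$ as an optimal solution.
   Formalization: That a run never stops without a verdict is claimed only if the vector (d_x,d_y) required in step (3) of Algorithm 2 always exists, which (i) and (ii) do not guarantee (e.g. g=|y|^2-1 with y_1=1); finiteness of runs and correctness of verdicts need no such premise. *)

theory Defs
  imports "HOL-Analysis.Analysis"
begin

section \<open>The joint mixed-integer convex program\<close>

text \<open>
  The variable is a pair \<open>(x, y)\<close>, \<open>x\<close> ranging over \<open>\<real>\<^sup>m\<close> and \<open>y\<close> over \<open>\<real>\<^sup>n\<close>. The set \<open>intv\<close>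
  is the set of those coordinates of \<open>y\<close> that are required to be integral; it may be
  empty or everything, so that \<open>l\<^sub>2 = card intv\<close> and \<open>l\<^sub>2 + l\<^sub>3 = CARD('n)\<close>.
\<close>

record ('m :: finite, 'n :: finite, 'r :: finite, 'i) jmicp =
  cost_x :: "real ^ 'm"
  cost_y :: "real ^ 'n"
  mat_T :: "real ^ 'm ^ 'r"
  mat_W :: "real ^ 'n ^ 'r"
  rhs_q :: "real ^ 'r"
  X_set :: "(real ^ 'm) set"
  Y_set :: "(real ^ 'n) set"
  idx :: "'i set"
  gfun :: "'i \<Rightarrow> (real ^ 'm) \<times> (real ^ 'n) \<Rightarrow> real"
  intv :: "'n set"

definition zero_one :: "(real ^ ('m :: finite)) set" where
  "zero_one = {x. \<forall>j. x $ j \<in> {0, 1}}"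

definition mixed_int :: "('m :: finite, 'n :: finite, 'r :: finite, 'i) jmicp \<Rightarrow> (real ^ 'n) set" where
  "mixed_int P = {y. \<forall>j\<in>intv P. y $ j \<in> \<int>}"

definition lin_eq :: "('m :: finite, 'n :: finite, 'r :: finite, 'i) jmicp
    \<Rightarrow> ((real ^ 'm) \<times> (real ^ 'n)) set" where
  "lin_eq P = {(x, y). mat_T P *v x + mat_W P *v y = rhs_q P}"

definition G_set :: "('m :: finite, 'n :: finite, 'r :: finite, 'i) jmicp
    \<Rightarrow> ((real ^ 'm) \<times> (real ^ 'n)) set" where
  "G_set P = {v. \<forall>i\<in>idx P. gfun P i v \<le> 0}"

definition S_set :: "('m :: finite, 'n :: finite, 'r :: finite, 'i) jmicp
    \<Rightarrow> ((real ^ 'm) \<times> (real ^ 'n)) set" where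
  "S_set P = {(x, y). (x, y) \<in> G_set P \<and> y \<in> Y_set P}"

definition feasible :: "('m :: finite, 'n :: finite, 'r :: finite, 'i) jmicp
    \<Rightarrow> ((real ^ 'm) \<times> (real ^ 'n)) set" where
  "feasible P = {(x, y). (x, y) \<in> lin_eq P \<and> (\<forall>i\<in>idx P. gfun P i (x, y) \<le> 0) \<and>
     x \<in> X_set P \<inter> zero_one \<and> y \<in> Y_set P \<inter> mixed_int P}"

definition jmicp_optimal :: "('m :: finite, 'n :: finite, 'r :: finite, 'i) jmicp
    \<Rightarrow> (real ^ 'm) \<times> (real ^ 'n) \<Rightarrow> bool" where
  "jmicp_optimal P =
     is_arg_min (\<lambda>(x, y). cost_x P \<bullet> x + cost_y P \<bullet> y) (\<lambda>v. v \<in> feasible P)"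

text \<open>
  Second-stage feasible set at \<open>x\<close> with the integer components of \<open>y\<close> fixed to those of \<open>z\<close>
  and integrality dropped (the other components of \<open>z\<close> play no role).
\<close>

definition fixed_set :: "('m :: finite, 'n :: finite, 'r :: finite, 'i) jmicp
    \<Rightarrow> real ^ 'm \<Rightarrow> real ^ 'n \<Rightarrow> (real ^ 'n) set" where
  "fixed_set P x z = {y. (x, y) \<in> lin_eq P \<and> (\<forall>i\<in>idx P. gfun P i (x, y) \<le> 0) \<and>
     y \<in> Y_set P \<and> (\<forall>j\<in>intv P. y $ j = z $ j)}"

text \<open>Optimal values are extended reals: \<open>\<infinity>\<close> if infeasible, \<open>-\<infinity>\<close> if unbounded.\<close>

definition opt_value :: "('a \<Rightarrow> real) \<Rightarrow> 'a set \<Rightarrow> ereal" where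
  "opt_value f C = (INF v\<in>C. ereal (f v))"


section \<open>Convex functions and their oracles\<close>

definition subdifferential :: "('v :: real_inner \<Rightarrow> real) \<Rightarrow> 'v \<Rightarrow> 'v set" where
  "subdifferential f v = {d. \<forall>w. f w \<ge> f v + d \<bullet> (w - v)}"

text \<open>
  A function with domain \<open>\<real>\<^sup>k\<close>, \<open>1 \<le> k \<le> DIM('v)\<close>, is represented by a pair \<open>(K, f)\<close>: \<open>K\<close> is the set
  of its \<open>k\<close> variables (a set of standard basis vectors), and \<open>f\<close> is defined on all of \<open>'v\<close>
  but ignores the coordinates outside \<open>K\<close>. Accordingly \<open>\<real>\<^sup>k\<close> is \<open>span K\<close>.
\<close>

definition coord_part :: "'v :: euclidean_space set \<Rightarrow> 'v \<Rightarrow> 'v" where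
  "coord_part K v = (\<Sum>b\<in>K. (v \<bullet> b) *\<^sub>R b)"

definition convex_collection :: "('v :: euclidean_space set \<times> ('v \<Rightarrow> real)) set \<Rightarrow> bool" where
  "convex_collection F \<longleftrightarrow>
     (\<forall>(K, f)\<in>F. K \<subseteq> Basis \<and> K \<noteq> {} \<and> convex_on UNIV f \<and> (\<forall>v. f v = f (coord_part K v))) \<and>
     (\<forall>(K, f)\<in>F. \<forall>K' c. K' \<subseteq> K \<and> K' \<noteq> {} \<longrightarrow>
        (K', \<lambda>v. f (coord_part K' v + coord_part (K - K') c)) \<in> F)"

definition generated ::
    "('v :: euclidean_space set \<times> ('v \<Rightarrow> real)) set \<Rightarrow> 'v set \<Rightarrow> 'v set \<Rightarrow> bool" where
  "generated F K C \<longleftrightarrow> K \<subseteq> Basis \<and> K \<noteq> {} \<and>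
     (\<exists>\<Phi>. finite \<Phi> \<and> (\<forall>f\<in>\<Phi>. (K, f) \<in> F) \<and> C = {v \<in> span K. \<forall>f\<in>\<Phi>. f v \<le> 0})"

text \<open>Normal cone of \<open>C \<subseteq> \<real>\<^sup>k\<close> at a point \<open>v\<close> of \<open>C\<close>, formed in \<open>\<real>\<^sup>k = span K\<close>.\<close>

definition normal_cone :: "'v :: euclidean_space set \<Rightarrow> 'v set \<Rightarrow> 'v \<Rightarrow> 'v set" where
  "normal_cone K C v = {d \<in> span K. \<forall>w\<in>C. d \<bullet> (w - v) \<le> 0}"

text \<open>
  A cut \<open>(\<alpha>, \<beta>, \<gamma>)\<close> stands for the inequality \<open>\<alpha> \<bullet> x + \<beta> \<bullet> y \<le> \<gamma>\<close>; a finite set of cuts plays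
  the role of a system \<open>C x + D y \<le> F\<close>.
\<close>

type_synonym ('m, 'n) cut = "(real ^ 'm) \<times> (real ^ 'n) \<times> real"

definition satisfies :: "('m :: finite, 'n :: finite) cut set \<Rightarrow> ((real ^ 'm) \<times> (real ^ 'n)) set" where
  "satisfies \<Lambda> = {(x, y). \<forall>(\<alpha>, \<beta>, \<gamma>)\<in>\<Lambda>. \<alpha> \<bullet> x + \<beta> \<bullet> y \<le> \<gamma>}"

text \<open>
  Oracles may be nondeterministic. \<open>solve K f C a\<close>: the convex optimization oracle may answer \<open>a\<close>
  on the problem of minimizing \<open>f\<close> over \<open>C \<subseteq> span K\<close>, \<open>None\<close> meaning infeasibility.
  \<open>milp x \<Lambda> a\<close>: the parametric pure cutting-plane oracle may answer \<open>a\<close> on the master problem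
  at \<open>x\<close> with cuts \<open>\<Lambda>\<close>; an answer \<open>Some (y, M)\<close> consists of a solution \<open>y\<close> and the inequality
  system \<open>M\<close> of the final linear program.
\<close>

record ('m :: finite, 'n :: finite) oracles =
  solve :: "((real ^ 'm) \<times> (real ^ 'n)) set \<Rightarrow> ((real ^ 'm) \<times> (real ^ 'n) \<Rightarrow> real) \<Rightarrow>
              ((real ^ 'm) \<times> (real ^ 'n)) set \<Rightarrow> ((real ^ 'm) \<times> (real ^ 'n)) option \<Rightarrow> bool"
  subgrad :: "((real ^ 'm) \<times> (real ^ 'n)) set \<Rightarrow> ((real ^ 'm) \<times> (real ^ 'n) \<Rightarrow> real) \<Rightarrow>
              (real ^ 'm) \<times> (real ^ 'n) \<Rightarrow> (real ^ 'm) \<times> (real ^ 'n)"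
  ncone :: "((real ^ 'm) \<times> (real ^ 'n)) set \<Rightarrow> ((real ^ 'm) \<times> (real ^ 'n)) set \<Rightarrow>
              (real ^ 'm) \<times> (real ^ 'n) \<Rightarrow> ((real ^ 'm) \<times> (real ^ 'n)) set"
  milp :: "real ^ 'm \<Rightarrow> ('m, 'n) cut set \<Rightarrow> ((real ^ 'n) \<times> ('m, 'n) cut set) option \<Rightarrow> bool"

text \<open>
  The optimization oracle is only obliged to answer if the problem is infeasible or has an
  optimal solution: a convex problem whose infimum is not attained admits no correct answer.
\<close>

definition convex_oracles :: "(((real ^ 'm) \<times> (real ^ 'n)) set \<times> ((real ^ 'm) \<times> (real ^ 'n) \<Rightarrow> real)) set
    \<Rightarrow> ('m :: finite, 'n :: finite) oracles \<Rightarrow> bool" where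
  "convex_oracles F Q \<longleftrightarrow>
     (\<forall>K f C. generated F K C \<and> convex_on UNIV f \<longrightarrow>
        (\<forall>v. solve Q K f C (Some v) \<longrightarrow> is_arg_min f (\<lambda>w. w \<in> C) v) \<and>
        (solve Q K f C None \<longrightarrow> C = {}) \<and>
        (C = {} \<or> (\<exists>v. is_arg_min f (\<lambda>w. w \<in> C) v) \<longrightarrow> (\<exists>a. solve Q K f C a))) \<and>
     (\<forall>(K, f)\<in>F. \<forall>v. subgrad Q K f v \<in> subdifferential f v) \<and>
     (\<forall>K C v. generated F K C \<and> v \<in> C \<longrightarrow> ncone Q K C v = normal_cone K C v)"


section \<open>The cutting-plane method for the second-stage problem\<close>

definition master :: "('m :: finite, 'n :: finite, 'r :: finite, 'i) jmicp
    \<Rightarrow> ('m, 'n) cut set \<Rightarrow> ((real ^ 'm) \<times> (real ^ 'n)) set" where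
  "master P \<Lambda> = {(x, y). (x, y) \<in> lin_eq P \<and> y \<in> Y_set P \<inter> mixed_int P \<and> (x, y) \<in> satisfies \<Lambda>}"

definition lp_set :: "('m :: finite, 'n :: finite, 'r :: finite, 'i) jmicp
    \<Rightarrow> ('m, 'n) cut set \<Rightarrow> real ^ 'm \<Rightarrow> (real ^ 'n) set" where
  "lp_set P M x = {y. (x, y) \<in> lin_eq P \<and> (x, y) \<in> satisfies M}"

text \<open>
  \<open>M\<close> comprises every inequality of the final linear program, i.e. a description of \<open>Y\<close>, the
  given cuts \<open>\<Lambda>\<close> and the generated cutting planes; all that is required of it is validity and
  that the linear program is solved by the master solution.
\<close>

definition milp_oracle :: "('m :: finite, 'n :: finite, 'r :: finite, 'i) jmicp
    \<Rightarrow> ('m, 'n) oracles \<Rightarrow> bool" where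
  "milp_oracle P Q \<longleftrightarrow> (\<forall>x \<in> X_set P \<inter> zero_one. \<forall>\<Lambda>. finite \<Lambda> \<longrightarrow>
     (\<exists>a. milp Q x \<Lambda> a) \<and>
     (milp Q x \<Lambda> None \<longrightarrow> {y. (x, y) \<in> master P \<Lambda>} = {}) \<and>
     (\<forall>y M. milp Q x \<Lambda> (Some (y, M)) \<longrightarrow>
        is_arg_min (\<lambda>y. cost_y P \<bullet> y) (\<lambda>y. (x, y) \<in> master P \<Lambda>) y \<and>
        finite M \<and> {(x', y') \<in> master P \<Lambda>. x' \<in> zero_one} \<subseteq> satisfies M \<and>
        is_arg_min (\<lambda>y. cost_y P \<bullet> y) (\<lambda>y. y \<in> lp_set P M x) y))"

definition projection_cut ::
    "(real ^ 'm) \<times> (real ^ 'n) \<Rightarrow> (real ^ 'm) \<times> (real ^ 'n) \<Rightarrow> ('m :: finite, 'n :: finite) cut" where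
  "projection_cut v p = (fst (v - p), snd (v - p), (v - p) \<bullet> p)"

definition normal_cut ::
    "(real ^ 'm) \<times> (real ^ 'n) \<Rightarrow> (real ^ 'm) \<times> (real ^ 'n) \<Rightarrow> ('m :: finite, 'n :: finite) cut" where
  "normal_cut d v = (fst d, snd d, d \<bullet> v)"

text \<open>
  Problems in \<open>y\<close> alone, i.e. with \<open>x\<close> fixed, are handed to the oracles as problems in the
  variables \<open>y_coords\<close>; their points are the pairs \<open>(0, y)\<close>.
\<close>

definition y_coords :: "((real ^ ('m :: finite)) \<times> (real ^ ('n :: finite))) set" where
  "y_coords = {0} \<times> Basis"

text \<open>The vectors \<open>d\<close> that may be used for the cut at the solution \<open>y'\<close> of the program with the
  integer components fixed to those of \<open>z\<close>.\<close>

definition cut_normal :: "('m :: finite, 'n :: finite, 'r :: finite, 'i) jmicp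
    \<Rightarrow> ('m, 'n) oracles \<Rightarrow> real ^ 'm \<Rightarrow> real ^ 'n \<Rightarrow> real ^ 'n \<Rightarrow> (real ^ 'm) \<times> (real ^ 'n) \<Rightarrow> bool" where
  "cut_normal P Q x z y' d \<longleftrightarrow>
     d \<in> ncone Q Basis (G_set P) (x, y') \<and>
     (0, snd d) \<in> ncone Q y_coords ({0} \<times> {y. (x, y) \<in> G_set P}) (0, y') \<and>
     opt_value (\<lambda>y. cost_y P \<bullet> y)
       {y. (x, y) \<in> lin_eq P \<and> snd d \<bullet> (y - y') \<le> 0 \<and> y \<in> Y_set P \<and> (\<forall>j\<in>intv P. y $ j = z $ j)}
     = opt_value (\<lambda>y. cost_y P \<bullet> y) (fixed_set P x z)"

datatype ('m, 'n) outcome =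
    Proceed "('m :: finite, 'n :: finite) cut set"
  | Returned "real ^ 'n" "('m, 'n) cut set"
  | NoSolution

text \<open>
  \<open>second_iter P Q x \<Lambda> r\<close>: one iteration at \<open>x\<close>, started with the cuts \<open>\<Lambda>\<close>, may end with \<open>r\<close>.
  If \<open>S_set P\<close> is empty there is no projection; the oracle then detects this, and infeasibility
  of the second-stage problem is claimed.
\<close>

inductive second_iter :: "('m :: finite, 'n :: finite, 'r :: finite, 'i) jmicp
    \<Rightarrow> ('m, 'n) oracles \<Rightarrow> real ^ 'm \<Rightarrow> ('m, 'n) cut set \<Rightarrow> ('m, 'n) outcome \<Rightarrow> bool"
  for P Q x \<Lambda> where
  master_infeasible:
    "milp Q x \<Lambda> None \<Longrightarrow> second_iter P Q x \<Lambda> NoSolution"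
| master_solves:
    "milp Q x \<Lambda> (Some (y, M)) \<Longrightarrow> (x, y) \<in> S_set P \<Longrightarrow> second_iter P Q x \<Lambda> (Returned y M)"
| S_empty:
    "milp Q x \<Lambda> (Some (y, M)) \<Longrightarrow> (x, y) \<notin> S_set P \<Longrightarrow>
     solve Q Basis (\<lambda>v. dist v (x, y)) (S_set P) None \<Longrightarrow>
     second_iter P Q x \<Lambda> NoSolution"
| fixed_infeasible:
    "milp Q x \<Lambda> (Some (y, M)) \<Longrightarrow> (x, y) \<notin> S_set P \<Longrightarrow>
     solve Q Basis (\<lambda>v. dist v (x, y)) (S_set P) (Some p) \<Longrightarrow>
     solve Q y_coords (\<lambda>v. cost_y P \<bullet> snd v) ({0} \<times> fixed_set P x y) None \<Longrightarrow>
     second_iter P Q x \<Lambda> (Proceed (insert (projection_cut (x, y) p) \<Lambda>))"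
| fixed_solves:
    "milp Q x \<Lambda> (Some (y, M)) \<Longrightarrow> (x, y) \<notin> S_set P \<Longrightarrow>
     solve Q Basis (\<lambda>v. dist v (x, y)) (S_set P) (Some p) \<Longrightarrow>
     solve Q y_coords (\<lambda>v. cost_y P \<bullet> snd v) ({0} \<times> fixed_set P x y) (Some (0, y')) \<Longrightarrow>
     cost_y P \<bullet> y' = cost_y P \<bullet> y \<Longrightarrow>
     second_iter P Q x \<Lambda> (Returned y' M)"
| fixed_boundary:
    "milp Q x \<Lambda> (Some (y, M)) \<Longrightarrow> (x, y) \<notin> S_set P \<Longrightarrow>
     solve Q Basis (\<lambda>v. dist v (x, y)) (S_set P) (Some p) \<Longrightarrow>
     solve Q y_coords (\<lambda>v. cost_y P \<bullet> snd v) ({0} \<times> fixed_set P x y) (Some (0, y')) \<Longrightarrow>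
     cost_y P \<bullet> y' \<noteq> cost_y P \<bullet> y \<Longrightarrow>
     (x, y') \<in> frontier (S_set P) \<Longrightarrow> cut_normal P Q x y y' d \<Longrightarrow>
     second_iter P Q x \<Lambda>
       (Proceed (insert (normal_cut d (x, y')) (insert (projection_cut (x, y) p) \<Lambda>)))"
| fixed_interior:
    "milp Q x \<Lambda> (Some (y, M)) \<Longrightarrow> (x, y) \<notin> S_set P \<Longrightarrow>
     solve Q Basis (\<lambda>v. dist v (x, y)) (S_set P) (Some p) \<Longrightarrow>
     solve Q y_coords (\<lambda>v. cost_y P \<bullet> snd v) ({0} \<times> fixed_set P x y) (Some (0, y')) \<Longrightarrow>
     cost_y P \<bullet> y' \<noteq> cost_y P \<bullet> y \<Longrightarrow>
     (x, y') \<notin> frontier (S_set P) \<Longrightarrow>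
     second_iter P Q x \<Lambda> (Proceed (insert (projection_cut (x, y) p) \<Lambda>))"


section \<open>The decomposition cutting-plane algorithm\<close>

text \<open>
  Dual of \<open>min {h \<bullet> y | W y = q - T x, D y \<le> F - C x}\<close>, where \<open>M\<close> is the system \<open>C x + D y \<le> F\<close>;
  the multipliers of the inequalities are indexed by \<open>M\<close>.
\<close>

definition dual_feasible :: "('m :: finite, 'n :: finite, 'r :: finite, 'i) jmicp
    \<Rightarrow> ('m, 'n) cut set \<Rightarrow> real ^ 'r \<Rightarrow> (('m, 'n) cut \<Rightarrow> real) \<Rightarrow> bool" where
  "dual_feasible P M \<mu> lam \<longleftrightarrow> (\<forall>k\<in>M. lam k \<ge> 0) \<and>
     transpose (mat_W P) *v \<mu> - (\<Sum>(\<alpha>, \<beta>, \<gamma>)\<in>M. lam (\<alpha>, \<beta>, \<gamma>) *\<^sub>R \<beta>) = cost_y P"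

definition dual_optimal :: "('m :: finite, 'n :: finite, 'r :: finite, 'i) jmicp
    \<Rightarrow> ('m, 'n) cut set \<Rightarrow> real ^ 'm \<Rightarrow> (real ^ 'r) \<times> (('m, 'n) cut \<Rightarrow> real) \<Rightarrow> bool" where
  "dual_optimal P M x = is_arg_max
     (\<lambda>(\<mu>, lam). \<mu> \<bullet> (rhs_q P - mat_T P *v x)
                 - (\<Sum>(\<alpha>, \<beta>, \<gamma>)\<in>M. lam (\<alpha>, \<beta>, \<gamma>) * (\<gamma> - \<alpha> \<bullet> x)))
     (\<lambda>(\<mu>, lam). dual_feasible P M \<mu> lam)"

text \<open>The pair \<open>(a, b)\<close> of the cut \<open>\<eta> \<ge> a \<bullet> x + b\<close>.\<close>

definition benders_cut :: "('m :: finite, 'n :: finite, 'r :: finite, 'i) jmicp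
    \<Rightarrow> ('m, 'n) cut set \<Rightarrow> real ^ 'r \<Rightarrow> (('m, 'n) cut \<Rightarrow> real) \<Rightarrow> (real ^ 'm) \<times> real" where
  "benders_cut P M \<mu> lam =
     ((\<Sum>(\<alpha>, \<beta>, \<gamma>)\<in>M. lam (\<alpha>, \<beta>, \<gamma>) *\<^sub>R \<alpha>) - transpose (mat_T P) *v \<mu>,
      - ((\<Sum>(\<alpha>, \<beta>, \<gamma>)\<in>M. lam (\<alpha>, \<beta>, \<gamma>) * \<gamma>) - \<mu> \<bullet> rhs_q P))"

definition feasibility_cut :: "real ^ 'm \<Rightarrow> (real ^ ('m :: finite)) set" where
  "feasibility_cut x0 = {x. (\<Sum>j | x0 $ j = 0. x $ j) + (\<Sum>j | x0 $ j = 1. 1 - x $ j) \<ge> 1}"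

text \<open>\<open>B\<close> holds the Benders cuts, \<open>N\<close> the points at which feasibility cuts were added.\<close>

definition first_stage :: "('m :: finite, 'n :: finite, 'r :: finite, 'i) jmicp
    \<Rightarrow> ((real ^ 'm) \<times> real) set \<Rightarrow> (real ^ 'm) set \<Rightarrow> ((real ^ 'm) \<times> real) set" where
  "first_stage P B N = {(x, \<eta>). x \<in> X_set P \<inter> zero_one \<and> (\<forall>(a, b)\<in>B. \<eta> \<ge> a \<bullet> x + b) \<and>
     (\<forall>x0\<in>N. x \<in> feasibility_cut x0)}"

definition first_stage_value :: "('m :: finite, 'n :: finite, 'r :: finite, 'i) jmicp
    \<Rightarrow> ((real ^ 'm) \<times> real) set \<Rightarrow> (real ^ 'm) set \<Rightarrow> ereal" where
  "first_stage_value P B N = opt_value (\<lambda>(x, \<eta>). cost_x P \<bullet> x + \<eta>) (first_stage P B N)"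

text \<open>
  As long as there is no Benders cut, \<open>\<eta>\<close> is unbounded below: the first-stage problem has value
  \<open>-\<infinity>\<close>, and every feasible \<open>x\<close> counts as optimal. Otherwise the infimum over \<open>\<eta>\<close> is attained,
  and this says that \<open>(x, \<eta>)\<close> is an optimal solution for some \<open>\<eta>\<close>.
\<close>

definition first_stage_solution :: "('m :: finite, 'n :: finite, 'r :: finite, 'i) jmicp
    \<Rightarrow> ((real ^ 'm) \<times> real) set \<Rightarrow> (real ^ 'm) set \<Rightarrow> real ^ 'm \<Rightarrow> bool" where
  "first_stage_solution P B N x \<longleftrightarrow> (\<exists>\<eta>. (x, \<eta>) \<in> first_stage P B N) \<and>
     opt_value (\<lambda>\<eta>. cost_x P \<bullet> x + \<eta>) {\<eta>. (x, \<eta>) \<in> first_stage P B N} = first_stage_value P B N"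

datatype ('m, 'n) verdict = Infeasible | Solution "real ^ ('m :: finite)" "real ^ ('n :: finite)"

text \<open>
  \<open>Loop L U B N s\<close>: at the head of the while loop, \<open>s\<close> being the pair \<open>(x\<^sup>m, y\<^sup>m)\<close> of the last
  iteration if its second-stage problem was solvable.
  \<open>Second L B N x \<Lambda>\<close>: the second-stage problem at \<open>x\<close> is being solved, with the cuts \<open>\<Lambda>\<close> added
  so far.
\<close>

datatype ('m, 'n) state =
    Loop ereal ereal "((real ^ ('m :: finite)) \<times> real) set" "(real ^ 'm) set"
      "((real ^ 'm) \<times> (real ^ ('n :: finite))) option"
  | Second ereal "((real ^ 'm) \<times> real) set" "(real ^ 'm) set" "real ^ 'm" "('m, 'n) cut set"
  | Halt "('m, 'n) verdict"

definition start :: "('m :: finite, 'n :: finite) state" where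
  "start = Loop (-\<infinity>) \<infinity> {} {} None"

text \<open>
  An infeasible second-stage problem has optimal value \<open>\<infinity>\<close>, hence \<open>U\<close> becomes \<open>\<infinity>\<close> there.
\<close>

inductive step :: "('m :: finite, 'n :: finite, 'r :: finite, 'i) jmicp
    \<Rightarrow> ('m, 'n) oracles \<Rightarrow> ('m, 'n) state \<Rightarrow> ('m, 'n) state \<Rightarrow> bool"
  for P Q where
  loop_end:
    "\<not> L < U \<Longrightarrow> step P Q (Loop L U B N (Some (x, y))) (Halt (Solution x y))"
| first_infeasible:
    "L < U \<Longrightarrow> first_stage P B N = {} \<Longrightarrow> step P Q (Loop L U B N s) (Halt Infeasible)"
| first_solved:
    "L < U \<Longrightarrow> first_stage_solution P B N x \<Longrightarrow>
     step P Q (Loop L U B N s) (Second (first_stage_value P B N) B N x {})"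
| second_proceeds:
    "second_iter P Q x \<Lambda> (Proceed \<Lambda>') \<Longrightarrow>
     step P Q (Second L B N x \<Lambda>) (Second L B N x \<Lambda>')"
| second_solved:
    "second_iter P Q x \<Lambda> (Returned y M) \<Longrightarrow> dual_optimal P M x (\<mu>, lam) \<Longrightarrow>
     step P Q (Second L B N x \<Lambda>)
       (Loop L (ereal (cost_x P \<bullet> x + cost_y P \<bullet> y)) (insert (benders_cut P M \<mu> lam) B) N
         (Some (x, y)))"
| second_infeasible:
    "second_iter P Q x \<Lambda> NoSolution \<Longrightarrow>
     step P Q (Second L B N x \<Lambda>) (Loop L \<infinity> B (insert x N) None)"

text \<open>
  Executability of the normal-cone step: whenever its preconditions hold, there is a vector \<open>d\<close>
  as the algorithm demands it. This does not follow from the non-emptiness of relative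
  interiors, which holds for every non-empty convex set.
\<close>

definition cut_normals_exist :: "('m :: finite, 'n :: finite, 'r :: finite, 'i) jmicp
    \<Rightarrow> ('m, 'n) oracles \<Rightarrow> bool" where
  "cut_normals_exist P Q \<longleftrightarrow>
     (\<forall>x \<in> X_set P \<inter> zero_one. \<forall>z \<in> mixed_int P. \<forall>y.
        is_arg_min (\<lambda>y. cost_y P \<bullet> y) (\<lambda>y. y \<in> fixed_set P x z) y \<and> (x, y) \<in> frontier (S_set P)
        \<longrightarrow> (\<exists>d. cut_normal P Q x z y d))"

end

theory Submission
  imports Defs
begin

text \<open>
  Every cut is valid for \<open>S_set P\<close>. Along an infinite run of the second-stage method the
  projection cuts force a cluster point of the master solutions into \<open>S_set P\<close>, so infeasible
  integer assignments die out; a feasible assignment occurs at most once, because afterwards either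
  a normal cut bounds the master value on it from below by its optimal value or (at an interior
  point) the equality constraints alone already do. In the outer loop, weak LP duality makes the
  Benders cuts valid and strong LP duality makes them tight, so revisiting a solvable first-stage
  point yields \<open>U \<le> L\<close>; there are finitely many first-stage points.
\<close>

section \<open>Linear programming duality\<close>

text \<open>A projection cut removes the current point but not its integer assignment, so an
  infeasible assignment may recur, with no evident bound on how often. Hence the inner loop is
  handled by compactness, not by counting, and termination takes the form that no infinite run
  exists. In the outer loop \<open>U\<close> is overwritten at every visit and jumps back to
  \<infinity> after an infeasible one, so progress cannot be read off from \<open>U\<close>; the
  measure counts first-stage points that are neither excluded nor touched by a Benders cut.
  Optimality at the exit needs only that \<open>L\<close> bounds all costs from below and that
  \<open>U\<close> is the cost of the stored pair. Duality is derived from Farkas' lemma at a known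
  primal minimiser, the master solution, which by \<open>milp_oracle\<close> solves the final linear
  program.\<close>

lemma convex_cone_hull_finite_image:
  fixes v :: "'a \<Rightarrow> 'b::real_vector"
  assumes "finite I"
  shows "convex_cone hull (v ` I) = {\<Sum>i\<in>I. c i *\<^sub>R v i | c. \<forall>i\<in>I. 0 \<le> c i}" (is "?L = ?R")
proof
  show "?L \<subseteq> ?R"
  proof (rule hull_minimal)
    show "v ` I \<subseteq> ?R"
    proof (clarsimp)
      fix i assume i: "i \<in> I"
      then have "v i = (\<Sum>j\<in>I. (if j = i then 1 else 0) *\<^sub>R v j)"
        using assms by (simp add: if_distrib[of "\<lambda>c. c *\<^sub>R _"] sum.delta cong: if_cong)
      then show "\<exists>c. v i = (\<Sum>i\<in>I. c i *\<^sub>R v i) \<and> (\<forall>i\<in>I. 0 \<le> c i)"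
        by (intro exI[of _ "\<lambda>j. if j = i then 1 else 0"]) auto
    qed
    show "convex_cone ?R"
      unfolding convex_cone_iff
    proof (intro conjI ballI allI impI)
      show "0 \<in> ?R" by (auto intro!: exI[of _ "\<lambda>_. 0"])
    next
      fix a b assume "a \<in> ?R" "b \<in> ?R"
      then obtain c e where "a = (\<Sum>i\<in>I. c i *\<^sub>R v i)" "\<forall>i\<in>I. 0 \<le> c i"
        "b = (\<Sum>i\<in>I. e i *\<^sub>R v i)" "\<forall>i\<in>I. 0 \<le> e i" by auto
      then show "a + b \<in> ?R"
        by (auto intro!: exI[of _ "\<lambda>i. c i + e i"] simp: scaleR_add_left sum.distrib)
    next
      fix a :: 'b and t :: real assume "a \<in> ?R" "0 \<le> t"
      then obtain c where "a = (\<Sum>i\<in>I. c i *\<^sub>R v i)" "\<forall>i\<in>I. 0 \<le> c i" by auto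
      with \<open>0 \<le> t\<close> show "t *\<^sub>R a \<in> ?R"
        by (auto intro!: exI[of _ "\<lambda>i. t * c i"] simp: scaleR_sum_right)
    qed
  qed
next
  have "(\<Sum>i\<in>J. c i *\<^sub>R v i) \<in> ?L" if "\<forall>i\<in>I. 0 \<le> c i" "J \<subseteq> I" for c J
    using finite_subset[OF that(2) assms] that
    by (induction J rule: finite_induct)
      (auto intro: convex_cone_hull_add convex_cone_hull_mul hull_inc simp: convex_cone_hull_contains_0)
  then show "?R \<subseteq> ?L" by blast
qed

text \<open>A finitely generated cone is closed, so a vector outside it can be strictly separated
  from it; the negated normal of the separating hyperplane then satisfies all premises on
  \<open>u\<close> and violates the conclusion.\<close>

lemma farkas:
  fixes v :: "'a \<Rightarrow> 'b::euclidean_space"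
  assumes "finite I"
    and implied: "\<And>u. (\<And>i. i \<in> I \<Longrightarrow> v i \<bullet> u \<le> 0) \<Longrightarrow> h \<bullet> u \<le> 0"
  shows "\<exists>c. (\<forall>i\<in>I. 0 \<le> c i) \<and> h = (\<Sum>i\<in>I. c i *\<^sub>R v i)"
proof (rule ccontr)
  let ?C = "convex_cone hull (v ` I)"
  assume "\<not> ?thesis"
  then have "h \<notin> ?C" by (auto simp: convex_cone_hull_finite_image[OF assms(1)])
  then obtain a b where ab: "a \<bullet> h < b" "\<And>x. x \<in> ?C \<Longrightarrow> b < a \<bullet> x"
    using separating_hyperplane_closed_point[of ?C h] assms(1)
    by (auto simp: convex_convex_cone_hull closed_convex_cone_hull)
  have "b < 0" using ab(2)[OF convex_cone_hull_contains_0] by simp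
  have "0 \<le> a \<bullet> v i" if "i \<in> I" for i
  proof (rule ccontr)
    assume neg: "\<not> 0 \<le> a \<bullet> v i"
    \<comment> \<open>This multiple of \<open>v i\<close> has inner product exactly \<open>b\<close>
      with \<open>a\<close>, which strict separation forbids.\<close>
    have "(b / (a \<bullet> v i)) *\<^sub>R v i \<in> ?C"
      using neg \<open>b < 0\<close> that by (intro convex_cone_hull_mul hull_inc) (auto simp: divide_nonpos_nonpos)
    from ab(2)[OF this] neg show False by simp
  qed
  then have "h \<bullet> (- a) \<le> 0" by (intro implied) (simp add: inner_commute)
  with ab(1) \<open>b < 0\<close> show False by (simp add: inner_commute)
qed

text \<open>Only the constraints active at \<open>y0\<close> restrict small moves away from it. If
  \<open>u\<close> satisfies the Farkas premises, then \<open>y0 - t *\<^sub>R u\<close> is feasible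
  for small positive \<open>t\<close>, and optimality forces \<open>h \<bullet> u \<le> 0\<close>;
  the Farkas coefficients are the multipliers.\<close>

lemma lp_strong_duality:
  fixes W :: "real ^ 'n::finite ^ 'r::finite" and \<beta> :: "'k \<Rightarrow> real ^ 'n"
  assumes "finite I"
    and "W *v y0 = d" and feas: "\<forall>k\<in>I. \<beta> k \<bullet> y0 \<le> \<delta> k"
    and opt: "\<And>y. W *v y = d \<Longrightarrow> \<forall>k\<in>I. \<beta> k \<bullet> y \<le> \<delta> k \<Longrightarrow> h \<bullet> y0 \<le> h \<bullet> y"
  shows "\<exists>\<mu> c. (\<forall>k\<in>I. 0 \<le> c k) \<and> transpose W *v \<mu> - (\<Sum>k\<in>I. c k *\<^sub>R \<beta> k) = h \<and>
    \<mu> \<bullet> d - (\<Sum>k\<in>I. c k * \<delta> k) = h \<bullet> y0"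
proof -
  define J where "J = {k\<in>I. \<beta> k \<bullet> y0 = \<delta> k}"
  \<comment> \<open>Both signs of each row turn inequalities into \<open>W *v u = 0\<close>;
    \<open>\<beta>\<close> is negated because the move is along \<open>- u\<close>.\<close>
  define v where "v = case_sum (case_sum (\<lambda>r. row r W) (\<lambda>r. - row r W)) (\<lambda>k. - \<beta> k)"
  have "finite J" "J \<subseteq> I" using assms(1) by (auto simp: J_def)
  have "h \<bullet> u \<le> 0" if u: "\<And>i. i \<in> (UNIV <+> UNIV) <+> J \<Longrightarrow> v i \<bullet> u \<le> 0" for u
  proof -
    have "row r W \<bullet> u = 0" for r
      using u[of "Inl (Inl r)"] u[of "Inl (Inr r)"] by (force simp: v_def)
    then have Wu: "W *v u = 0"
      by (simp add: vec_eq_iff matrix_vector_mult_def inner_vec_def row_def)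
    have bu: "0 \<le> \<beta> k \<bullet> u" if "k \<in> J" for k
      using u[of "Inr k"] that by (auto simp: v_def)
    have "\<forall>\<^sub>F t in at_right (0::real). \<beta> k \<bullet> (y0 - t *\<^sub>R u) \<le> \<delta> k" if "k \<in> I" for k
    proof (cases "k \<in> J")
      case True
      then show ?thesis using bu[OF True]
        by (auto simp: J_def inner_diff_right eventually_at_filter)
    next
      case False
      have "((\<lambda>t. \<beta> k \<bullet> (y0 - t *\<^sub>R u)) \<longlongrightarrow> \<beta> k \<bullet> (y0 - 0 *\<^sub>R u)) (at_right 0)"
        by (intro tendsto_intros)
      moreover have "\<beta> k \<bullet> (y0 - 0 *\<^sub>R u) < \<delta> k" using False feas that by (auto simp: J_def)
      ultimately show ?thesis
        by (rule eventually_mono[OF order_tendstoD(2)]) simp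
    qed
    then have "\<forall>\<^sub>F t in at_right (0::real). \<forall>k\<in>I. \<beta> k \<bullet> (y0 - t *\<^sub>R u) \<le> \<delta> k"
      using assms(1) by (simp add: eventually_ball_finite)
    then have "\<forall>\<^sub>F t in at_right (0::real). 0 < t \<and> (\<forall>k\<in>I. \<beta> k \<bullet> (y0 - t *\<^sub>R u) \<le> \<delta> k)"
      by (intro eventually_conj eventually_at_right_less)
    then obtain t :: real where t: "0 < t" "\<forall>k\<in>I. \<beta> k \<bullet> (y0 - t *\<^sub>R u) \<le> \<delta> k"
      using eventually_happens' trivial_limit_at_right_real by blast
    have "W *v (y0 - t *\<^sub>R u) = d"
      using assms(2) Wu by (simp add: matrix_vector_mult_diff_distrib matrix_vector_mult_scaleR)
    from opt[OF this t(2)] t(1) show ?thesis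
      by (simp add: inner_diff_right mult_le_0_iff)
  qed
  then obtain e where e: "\<forall>i\<in>(UNIV <+> UNIV) <+> J. 0 \<le> e i"
    "h = (\<Sum>i\<in>(UNIV <+> UNIV) <+> J. e i *\<^sub>R v i)"
    using farkas[of "(UNIV <+> UNIV) <+> J" v h] \<open>finite J\<close> by (auto simp: finite_Plus)
  \<comment> \<open>The equality multiplier is free, hence a difference of two nonnegative
    coefficients. That \<open>c\<close> vanishes on inactive constraints is complementary slackness,
    which equates dual and primal values.\<close>
  define \<mu> where "\<mu> = (\<chi> r. e (Inl (Inl r)) - e (Inl (Inr r)))"
  define c where "c k = (if k \<in> J then e (Inr k) else 0)" for k
  have W\<mu>: "transpose W *v \<mu> = (\<Sum>r\<in>UNIV. e (Inl (Inl r)) *\<^sub>R row r W) - (\<Sum>r\<in>UNIV. e (Inl (Inr r)) *\<^sub>R row r W)"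
    by (simp add: \<mu>_def matrix_mult_sum column_transpose scalar_mult_eq_scaleR scaleR_diff_left sum_subtractf)
  have sumJ: "(\<Sum>k\<in>I. c k *\<^sub>R w k) = (\<Sum>k\<in>J. e (Inr k) *\<^sub>R w k)" for w :: "'k \<Rightarrow> 'z::real_vector"
    using \<open>J \<subseteq> I\<close> assms(1) by (intro sum.mono_neutral_cong_right) (auto simp: c_def)
  have h: "transpose W *v \<mu> - (\<Sum>k\<in>I. c k *\<^sub>R \<beta> k) = h"
    unfolding sumJ W\<mu> e(2) using \<open>finite J\<close> by (simp add: sum.Plus finite_Plus v_def sum_negf del: UNIV_Plus_UNIV)
  have "(\<Sum>k\<in>I. c k * \<delta> k) = (\<Sum>k\<in>I. c k * (\<beta> k \<bullet> y0))"
    by (intro sum.cong) (auto simp: c_def J_def)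
  then have "\<mu> \<bullet> d - (\<Sum>k\<in>I. c k * \<delta> k) = h \<bullet> y0"
    by (simp add: h[symmetric] inner_diff_left dot_lmul_matrix assms(2) inner_sum_left)
  moreover have "\<forall>k\<in>I. 0 \<le> c k" using e(1) by (auto simp: c_def)
  ultimately show ?thesis using h by blast
qed

section \<open>Weak and strong duality for the final linear program\<close>

lemma dual_feasible_iff:
  "dual_feasible P M \<mu> lam \<longleftrightarrow> (\<forall>k\<in>M. lam k \<ge> 0) \<and>
     transpose (mat_W P) *v \<mu> - (\<Sum>k\<in>M. lam k *\<^sub>R fst (snd k)) = cost_y P"
  by (simp add: dual_feasible_def case_prod_beta)

definition dual_value where
  "dual_value P M x \<mu> lam =
     \<mu> \<bullet> (rhs_q P - mat_T P *v x) - (\<Sum>k\<in>M. lam k * (snd (snd k) - fst k \<bullet> x))"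

lemma dual_optimal_iff:
  "dual_optimal P M x (\<mu>, lam) \<longleftrightarrow> dual_feasible P M \<mu> lam \<and>
     (\<forall>\<mu>' lam'. dual_feasible P M \<mu>' lam' \<longrightarrow> dual_value P M x \<mu>' lam' \<le> dual_value P M x \<mu> lam)"
  by (auto simp: dual_optimal_def is_arg_max_def dual_value_def case_prod_beta not_less)

text \<open>Dual feasibility does not involve \<open>x\<close>, and the dual objective is affine in
  it, so multipliers found at one first-stage point give a bound at all of them: this is the Benders
  cut.\<close>

lemma benders_cut_value:
  "fst (benders_cut P M \<mu> lam) \<bullet> x + snd (benders_cut P M \<mu> lam) = dual_value P M x \<mu> lam"
  by (simp add: benders_cut_def dual_value_def case_prod_beta inner_diff_left inner_diff_right
      dot_lmul_matrix inner_sum_left sum_subtractf right_diff_distrib)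

lemma satisfies_iff: "(x, y) \<in> satisfies M \<longleftrightarrow> (\<forall>k\<in>M. fst (snd k) \<bullet> y \<le> snd (snd k) - fst k \<bullet> x)"
  by (force simp: satisfies_def)

lemma lp_set_iff:
  "y \<in> lp_set P M x \<longleftrightarrow> mat_W P *v y = rhs_q P - mat_T P *v x \<and>
     (\<forall>k\<in>M. fst (snd k) \<bullet> y \<le> snd (snd k) - fst k \<bullet> x)"
  by (auto simp: lp_set_def satisfies_iff lin_eq_def algebra_simps)

lemma dual_value_le:
  assumes "dual_feasible P M \<mu> lam" "y \<in> lp_set P M x"
  shows "dual_value P M x \<mu> lam \<le> cost_y P \<bullet> y"
proof -
  have "(\<Sum>k\<in>M. lam k * (fst (snd k) \<bullet> y)) \<le> (\<Sum>k\<in>M. lam k * (snd (snd k) - fst k \<bullet> x))"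
    using assms by (intro sum_mono mult_left_mono) (auto simp: dual_feasible_iff lp_set_iff)
  moreover have "cost_y P \<bullet> y = \<mu> \<bullet> (rhs_q P - mat_T P *v x) - (\<Sum>k\<in>M. lam k * (fst (snd k) \<bullet> y))"
    using assms by (auto simp: dual_feasible_iff lp_set_iff inner_diff_left dot_lmul_matrix inner_sum_left
        dest!: sym[of _ "cost_y P"])
  ultimately show ?thesis by (simp add: dual_value_def)
qed

lemma dual_attains:
  assumes "finite M" "is_arg_min (\<lambda>y. cost_y P \<bullet> y) (\<lambda>y. y \<in> lp_set P M x) y"
  shows "\<exists>\<mu> lam. dual_feasible P M \<mu> lam \<and> dual_value P M x \<mu> lam = cost_y P \<bullet> y"
proof -
  have "\<exists>\<mu> c. (\<forall>k\<in>M. 0 \<le> c k) \<and>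
      transpose (mat_W P) *v \<mu> - (\<Sum>k\<in>M. c k *\<^sub>R fst (snd k)) = cost_y P \<and>
      \<mu> \<bullet> (rhs_q P - mat_T P *v x) - (\<Sum>k\<in>M. c k * (snd (snd k) - fst k \<bullet> x)) = cost_y P \<bullet> y"
    using assms by (intro lp_strong_duality) (auto simp: is_arg_min_def lp_set_iff not_less)
  then show ?thesis by (auto simp: dual_feasible_iff dual_value_def)
qed

lemma dual_optimal_exists:
  assumes "finite M" "is_arg_min (\<lambda>y. cost_y P \<bullet> y) (\<lambda>y. y \<in> lp_set P M x) y"
  shows "\<exists>\<mu> lam. dual_optimal P M x (\<mu>, lam)"
proof -
  obtain \<mu> lam where "dual_feasible P M \<mu> lam" "dual_value P M x \<mu> lam = cost_y P \<bullet> y"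
    using dual_attains[OF assms] by blast
  moreover have "y \<in> lp_set P M x" using assms(2) by (simp add: is_arg_min_def)
  ultimately show ?thesis using dual_value_le by (fastforce simp: dual_optimal_iff)
qed

lemma dual_optimal_value:
  assumes "finite M" "is_arg_min (\<lambda>y. cost_y P \<bullet> y) (\<lambda>y. y \<in> lp_set P M x) y"
    and "dual_optimal P M x (\<mu>, lam)"
  shows "cost_y P \<bullet> y \<le> dual_value P M x \<mu> lam"
  using dual_attains[OF assms(1,2)] assms(3) by (metis dual_optimal_iff)


section \<open>Generated sets and binary points\<close>

lemma coord_part_Basis: "coord_part Basis v = v"
  by (simp add: coord_part_def euclidean_representation)

lemma coord_part_y_coords: "coord_part y_coords v = (0, snd v)"
proof -
  have "coord_part y_coords v = (\<Sum>b\<in>Pair 0 ` Basis. (v \<bullet> b) *\<^sub>R b)"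
    by (simp add: coord_part_def y_coords_def) (intro sum.cong, auto)
  also have "\<dots> = (\<Sum>b\<in>Basis. (0, (snd v \<bullet> b) *\<^sub>R b))"
    by (subst sum.reindex) (auto simp: inj_on_def inner_prod_def)
  also have "\<dots> = (0, snd v)"
    by (simp add: prod_eq_iff fst_sum snd_sum euclidean_representation)
  finally show ?thesis .
qed

lemma y_coords_subset: "y_coords \<subseteq> Basis"
  by (auto simp: y_coords_def Basis_prod_def)

lemma y_coords_nonempty: "y_coords \<noteq> {}"
  by (simp add: y_coords_def)

lemma coord_part_non_y_coords: "coord_part (Basis - y_coords) v = (fst v, 0)"
proof -
  have "coord_part (Basis - y_coords) v = coord_part Basis v - coord_part y_coords v"
    unfolding coord_part_def using y_coords_subset by (intro sum_diff) auto
  then show ?thesis by (simp add: coord_part_Basis coord_part_y_coords prod_eq_iff)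
qed

lemma span_y_coords: "span (y_coords :: ((real ^ 'm::finite) \<times> (real ^ 'n::finite)) set) = {0} \<times> UNIV"
    (is "span ?Y = ?R")
proof
  have "subspace ?R"
    by (intro subspace_Times) auto
  then show "span ?Y \<subseteq> ?R"
    by (intro span_minimal) (auto simp: y_coords_def)
  show "?R \<subseteq> span ?Y"
  proof
    fix v assume "v \<in> ?R"
    then have "v = coord_part ?Y v" by (auto simp: coord_part_y_coords)
    also have "\<dots> \<in> span ?Y"
      unfolding coord_part_def by (intro span_sum span_mul span_base)
    finally show "v \<in> span ?Y" .
  qed
qed

lemma generated_Basis_iff:
  "generated F Basis C \<longleftrightarrow> (\<exists>\<Phi>. finite \<Phi> \<and> (\<forall>f\<in>\<Phi>. (Basis, f) \<in> F) \<and> C = {v. \<forall>f\<in>\<Phi>. f v \<le> 0})"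
  by (simp add: generated_def)

lemma generated_Basis_INT:
  assumes "finite I" "\<And>i. i \<in> I \<Longrightarrow> generated F Basis (C i)"
  shows "generated F Basis {v. \<forall>i\<in>I. v \<in> C i}"
proof -
  have "\<forall>i\<in>I. \<exists>\<Phi>. finite \<Phi> \<and> (\<forall>f\<in>\<Phi>. (Basis, f) \<in> F) \<and> C i = {v. \<forall>f\<in>\<Phi>. f v \<le> 0}"
    using assms(2) by (simp add: generated_Basis_iff)
  from bchoice[OF this] obtain \<Phi>
    where "\<forall>i\<in>I. finite (\<Phi> i) \<and> (\<forall>f\<in>\<Phi> i. (Basis, f) \<in> F) \<and> C i = {v. \<forall>f\<in>\<Phi> i. f v \<le> 0}" by blast
  then show ?thesis
    using assms(1) unfolding generated_Basis_iff by (intro exI[of _ "\<Union>i\<in>I. \<Phi> i"]) auto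
qed

lemma generated_Basis_Int:
  assumes "generated F Basis C" "generated F Basis D"
  shows "generated F Basis (C \<inter> D)"
proof -
  have "generated F Basis {v. \<forall>E\<in>{C, D}. v \<in> E}"
    using assms by (intro generated_Basis_INT) auto
  then show ?thesis by (simp add: Int_def)
qed

lemma generated_Basis_single:
  "(Basis, f) \<in> F \<Longrightarrow> generated F Basis {v. f v \<le> 0}"
  unfolding generated_Basis_iff by (intro exI[of _ "{f}"]) auto

text \<open>The closure of \<open>F\<close> under fixing variables, used with the constants
  \<open>(x, 0)\<close> on the coordinates outside \<open>y_coords\<close>, lets the oracles handle
  problems in \<open>y\<close> alone.\<close>

lemma generated_slice:
  assumes F: "convex_collection F" and C: "generated F Basis C"
  shows "generated F y_coords ({0} \<times> {y. (x, y) \<in> C})"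
proof -
  obtain \<Phi> where \<Phi>: "finite \<Phi>" "\<forall>f\<in>\<Phi>. (Basis, f) \<in> F" "C = {v. \<forall>f\<in>\<Phi>. f v \<le> 0}"
    using C by (auto simp: generated_Basis_iff)
  have "(y_coords, \<lambda>v. f (x, snd v)) \<in> F" if "f \<in> \<Phi>" for f
  proof -
    have "(y_coords, \<lambda>v. f (coord_part y_coords v + coord_part (Basis - y_coords) (x, 0))) \<in> F"
      using F[unfolded convex_collection_def, THEN conjunct2, rule_format, OF \<Phi>(2)[rule_format, OF that],
          unfolded prod.case, rule_format, of y_coords "(x, 0)"]
      by (simp add: y_coords_subset y_coords_nonempty)
    then show ?thesis by (simp add: coord_part_y_coords coord_part_non_y_coords)
  qed
  then show ?thesis
    unfolding generated_def
    using y_coords_subset y_coords_nonempty \<Phi>(1,3)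
    by (intro conjI exI[of _ "(\<lambda>f v. f (x, snd v)) ` \<Phi>"]) (auto simp: span_y_coords)
qed

text \<open>Convex functions that are finite on the whole space are continuous, so their sublevel
  sets are closed as well as convex.\<close>

lemma generated_convex_closed:
  assumes "convex_collection F" "generated F Basis C"
  shows "convex C" "closed C"
proof -
  obtain \<Phi> where \<Phi>: "\<forall>f\<in>\<Phi>. (Basis, f) \<in> F" "C = {v. \<forall>f\<in>\<Phi>. f v \<le> 0}"
    using assms(2) by (auto simp: generated_Basis_iff)
  have conv: "convex_on UNIV f" if "f \<in> \<Phi>" for f
    using assms(1)[unfolded convex_collection_def, THEN conjunct1, rule_format, OF \<Phi>(1)[rule_format, OF that]]
    by simp
  have C: "C = (\<Inter>f\<in>\<Phi>. {v. f v \<le> 0})" using \<Phi>(2) by auto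
  have "convex {v. f v \<le> 0}" if "f \<in> \<Phi>" for f
  proof (rule convexI)
    fix v w and s t :: real assume *: "v \<in> {v. f v \<le> 0}" "w \<in> {v. f v \<le> 0}" "0 \<le> s" "0 \<le> t" "s + t = 1"
    then have "f (s *\<^sub>R v + t *\<^sub>R w) \<le> s * f v + t * f w"
      using conv[OF that] unfolding convex_on_def by blast
    also have "\<dots> \<le> 0" using * by (auto intro!: add_nonpos_nonpos mult_nonneg_nonpos)
    finally show "s *\<^sub>R v + t *\<^sub>R w \<in> {v. f v \<le> 0}" by simp
  qed
  then show "convex C" unfolding C by (intro convex_INT)
  have "closed {v. f v \<le> 0}" if "f \<in> \<Phi>" for f
    by (intro closed_Collect_le convex_on_continuous conv that open_UNIV continuous_on_const)
  then show "closed C" unfolding C by blast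
qed

section \<open>Binary vectors and feasibility cuts\<close>

lemma finite_zero_one: "finite (zero_one :: (real ^ 'm::finite) set)"
proof -
  have "zero_one \<subseteq> range (\<lambda>A :: 'm set. \<chi> j. if j \<in> A then 1 else (0::real))"
  proof
    fix x :: "real ^ 'm" assume "x \<in> zero_one"
    then have "x = (\<chi> j. if j \<in> {j. x $ j = 1} then 1 else 0)"
      by (auto simp: zero_one_def vec_eq_iff)
    then show "x \<in> range (\<lambda>A :: 'm set. \<chi> j. if j \<in> A then 1 else (0::real))" by blast
  qed
  then show ?thesis by (rule finite_subset) simp
qed

text \<open>For binary vectors the left-hand side of the cut is the Hamming distance from
  \<open>x0\<close>, so the cut removes \<open>x0\<close> and no other binary point.\<close>

lemma mem_feasibility_cut_iff:
  fixes x x0 :: "real ^ 'm::finite"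
  assumes "x \<in> zero_one" "x0 \<in> zero_one"
  shows "x \<in> feasibility_cut x0 \<longleftrightarrow> x \<noteq> x0"
proof -
  have "(\<Sum>j | x0 $ j = 0. x $ j) + (\<Sum>j | x0 $ j = 1. 1 - x $ j) = real (card {j. x $ j \<noteq> x0 $ j})"
  proof -
    have x: "x $ j = 0 \<or> x $ j = 1" "x0 $ j = 0 \<or> x0 $ j = 1" for j
      using assms by (auto simp: zero_one_def)
    have "(\<Sum>j | x0 $ j = 0. x $ j) = (\<Sum>j\<in>UNIV. if x0 $ j = 0 then x $ j else 0)"
      "(\<Sum>j | x0 $ j = 1. 1 - x $ j) = (\<Sum>j\<in>UNIV. if x0 $ j = 1 then 1 - x $ j else 0)"
      by (simp_all add: sum.If_cases)
    then have "(\<Sum>j | x0 $ j = 0. x $ j) + (\<Sum>j | x0 $ j = 1. 1 - x $ j)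
        = (\<Sum>j\<in>UNIV. (if x0 $ j = 0 then x $ j else 0) + (if x0 $ j = 1 then 1 - x $ j else 0))"
      by (simp add: sum.distrib)
    also have "\<dots> = (\<Sum>j\<in>UNIV. if x $ j \<noteq> x0 $ j then 1 else 0)"
      by (intro sum.cong refl) (use x in \<open>smt (verit)\<close>)
    also have "\<dots> = real (card {j. x $ j \<noteq> x0 $ j})"
      by (subst sum.If_cases) auto
    finally show ?thesis .
  qed
  moreover have "card {j. x $ j \<noteq> x0 $ j} \<ge> 1 \<longleftrightarrow> x \<noteq> x0"
    by (simp add: Suc_le_eq card_gt_0_iff vec_eq_iff)
  ultimately show ?thesis by (auto simp: feasibility_cut_def)
qed


section \<open>The second-stage problem\<close>

lemma mem_satisfies_projection_cut:
  "v \<in> satisfies (insert (projection_cut u p) \<Lambda>) \<longleftrightarrow> (u - p) \<bullet> (v - p) \<le> 0 \<and> v \<in> satisfies \<Lambda>"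
  by (cases v) (simp add: satisfies_def projection_cut_def inner_prod_def algebra_simps)

lemma mem_satisfies_normal_cut:
  "v \<in> satisfies (insert (normal_cut d u) \<Lambda>) \<longleftrightarrow> d \<bullet> (v - u) \<le> 0 \<and> v \<in> satisfies \<Lambda>"
  by (cases v) (simp add: satisfies_def normal_cut_def inner_prod_def algebra_simps)

lemma opt_value_le: "y \<in> C \<Longrightarrow> opt_value f C \<le> ereal (f y)"
  unfolding opt_value_def by (rule INF_lower)

lemma opt_value_ge: "(\<And>y. y \<in> C \<Longrightarrow> l \<le> ereal (f y)) \<Longrightarrow> l \<le> opt_value f C"
  unfolding opt_value_def by (rule INF_greatest)

lemma convex_on_dist_right: "convex_on UNIV (\<lambda>v. dist v (w :: 'a::real_normed_vector))"
  using convex_on_dist[of UNIV w] by (simp add: dist_commute)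

section \<open>Admissibility of the constraint sets for the oracles\<close>

locale jmicp_setting =
  fixes P :: "('m :: finite, 'n :: finite, 'r :: finite, 'i) jmicp"
    and F :: "(((real ^ 'm) \<times> (real ^ 'n)) set \<times> ((real ^ 'm) \<times> (real ^ 'n) \<Rightarrow> real)) set"
    and Q :: "('m, 'n) oracles"
  assumes Y_polyhedron: "polyhedron (Y_set P)" and Y_bounded: "bounded (Y_set P)"
    and finite_idx: "finite (idx P)"
    and collection: "convex_collection F"
    and gfun_in: "i \<in> idx P \<Longrightarrow> (Basis, gfun P i) \<in> F"
    and affine_in: "(Basis, \<lambda>v. a \<bullet> v - b) \<in> F"
    and oracles: "convex_oracles F Q"
    and milp: "milp_oracle P Q"
begin

abbreviation X01 where "X01 \<equiv> X_set P \<inter> zero_one"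

abbreviation obj where "obj y \<equiv> cost_y P \<bullet> y"

lemma generated_halfspace: "generated F Basis {v. a \<bullet> v \<le> b}"
  using generated_Basis_single[OF affine_in[of a b]] by simp

lemma generated_hyperplane: "generated F Basis {v. a \<bullet> v = b}"
proof -
  have "{v. a \<bullet> v = b} = {v. a \<bullet> v \<le> b} \<inter> {v. (- a) \<bullet> v \<le> - b}" by auto
  then show ?thesis by (simp only: generated_Basis_Int generated_halfspace)
qed

lemma generated_G: "generated F Basis (G_set P)"
  unfolding G_set_def
  using generated_Basis_INT[of "idx P" F "\<lambda>i. {v. gfun P i v \<le> 0}"] finite_idx gfun_in
  by (simp add: generated_Basis_single)

lemma generated_Y: "generated F Basis {v. snd v \<in> Y_set P}"
proof -
  obtain H where H: "finite H" "Y_set P = \<Inter> H" "\<forall>h\<in>H. \<exists>a b. h = {y. a \<bullet> y \<le> b}"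
    using Y_polyhedron unfolding polyhedron_def by metis
  have "generated F Basis {v. \<forall>h\<in>H. v \<in> {v. snd v \<in> h}}"
  proof (rule generated_Basis_INT)
    fix h assume "h \<in> H"
    then obtain a b where "h = {y. a \<bullet> y \<le> b}" using H(3) by blast
    then have "{v. snd v \<in> h} = {v :: (real ^ 'm) \<times> (real ^ 'n). (0, a) \<bullet> v \<le> b}" by (simp add: inner_prod_def)
    then show "generated F Basis {v. snd v \<in> h}" by (simp only: generated_halfspace)
  qed fact
  then show ?thesis using H(2) by simp
qed

lemma S_set_eq: "S_set P = G_set P \<inter> {v. snd v \<in> Y_set P}"
  by (auto simp: S_set_def)

lemma generated_S: "generated F Basis (S_set P)"
  unfolding S_set_eq by (intro generated_Basis_Int generated_G generated_Y)

lemma generated_lin_eq: "generated F Basis (lin_eq P)"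
proof -
  have "lin_eq P = {v. \<forall>r\<in>UNIV. v \<in> {v. (row r (mat_T P), row r (mat_W P)) \<bullet> v = rhs_q P $ r}}"
    by (auto simp: lin_eq_def vec_eq_iff matrix_vector_mult_def inner_vec_def row_def)
  also have "generated F Basis \<dots>"
    by (intro generated_Basis_INT generated_hyperplane) auto
  finally show ?thesis .
qed

text \<open>Formulated in the joint space, where the generating functions live; its slice at
  \<open>x\<close> is the integer-fixed program.\<close>

lemma generated_fixed:
  "generated F Basis (S_set P \<inter> lin_eq P \<inter> {v. \<forall>j\<in>intv P. snd v $ j = z $ j})"
proof -
  have "{v. \<forall>j\<in>intv P. snd v $ j = z $ j} = {v. \<forall>j\<in>intv P. v \<in> {v. (0, axis j 1) \<bullet> v = z $ j}}"
    by (simp add: inner_prod_def inner_axis')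
  also have "generated F Basis \<dots>"
    by (intro generated_Basis_INT generated_hyperplane) auto
  finally show ?thesis by (intro generated_Basis_Int generated_S generated_lin_eq)
qed

lemma fixed_set_eq:
  "fixed_set P x z = {y. (x, y) \<in> S_set P \<inter> lin_eq P \<inter> {v. \<forall>j\<in>intv P. snd v $ j = z $ j}}"
  by (auto simp: fixed_set_def S_set_def G_set_def)

lemma mem_fixed_set:
  "y \<in> fixed_set P x z \<longleftrightarrow> (x, y) \<in> S_set P \<and> (x, y) \<in> lin_eq P \<and> (\<forall>j\<in>intv P. y $ j = z $ j)"
  by (simp add: fixed_set_eq)

lemma feasible_iff:
  "(x, y) \<in> feasible P \<longleftrightarrow> x \<in> X01 \<and> (x, y) \<in> S_set P \<and> (x, y) \<in> lin_eq P \<and> y \<in> mixed_int P"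
  by (auto simp: feasible_def S_set_def G_set_def)

lemma closed_S: "closed (S_set P)" and convex_S: "convex (S_set P)"
  using generated_convex_closed[OF collection generated_S] by auto

text \<open>Compactness makes the minimum of the integer-fixed program attained whenever that
  program is feasible, so the optimization oracle is obliged to answer.\<close>

lemma compact_fixed_set: "compact (fixed_set P x z)"
proof -
  have "closed (Pair x -` (S_set P \<inter> lin_eq P \<inter> {v. \<forall>j\<in>intv P. snd v $ j = z $ j}))"
    using generated_convex_closed(2)[OF collection generated_fixed]
    by (rule continuous_closed_vimage) (intro continuous_intros)
  then have "closed (fixed_set P x z)" by (simp add: fixed_set_eq vimage_def)
  moreover have "bounded (fixed_set P x z)"
    by (rule bounded_subset[OF Y_bounded]) (auto simp: fixed_set_def)
  ultimately show ?thesis by (simp add: compact_eq_bounded_closed)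
qed

section \<open>Oracle answers and the outcome of one iteration\<close>

lemma convex_solve:
  assumes "generated F K C" "convex_on UNIV f"
  shows "solve Q K f C (Some v) \<Longrightarrow> v \<in> C \<and> (\<forall>w\<in>C. f v \<le> f w)"
    and "solve Q K f C None \<Longrightarrow> C = {}"
    and "C = {} \<or> (\<exists>v\<in>C. \<forall>w\<in>C. f v \<le> f w) \<Longrightarrow> \<exists>a. solve Q K f C a"
proof -
  have "generated F K C \<and> convex_on UNIV f" using assms ..
  note o = oracles[unfolded convex_oracles_def is_arg_min_linorder, THEN conjunct1, rule_format, OF this]
  show "solve Q K f C (Some v) \<Longrightarrow> v \<in> C \<and> (\<forall>w\<in>C. f v \<le> f w)"
    and "solve Q K f C None \<Longrightarrow> C = {}"
    and "C = {} \<or> (\<exists>v\<in>C. \<forall>w\<in>C. f v \<le> f w) \<Longrightarrow> \<exists>a. solve Q K f C a"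
    using o by blast+
qed

lemma convex_on_obj: "convex_on UNIV (\<lambda>v :: (real ^ 'm) \<times> (real ^ 'n). obj (snd v))"
  by (auto simp: convex_on_def inner_add_right)

text \<open>The second claim is the variational inequality for the nearest point of a closed convex
  set; it is precisely the validity of the projection cut on \<open>S_set P\<close>.\<close>

lemma solve_projection:
  assumes "solve Q Basis (\<lambda>v. dist v u) (S_set P) (Some p)"
  shows "p \<in> S_set P" and "w \<in> S_set P \<Longrightarrow> (u - p) \<bullet> (w - p) \<le> 0"
proof -
  have "p \<in> S_set P \<and> (\<forall>w\<in>S_set P. dist p u \<le> dist w u)"
    using convex_solve(1)[OF generated_S convex_on_dist_right assms] .
  then show "p \<in> S_set P" and "w \<in> S_set P \<Longrightarrow> (u - p) \<bullet> (w - p) \<le> 0"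
    using any_closest_point_dot[OF convex_S closed_S, of p w u] by (auto simp: dist_commute)
qed

lemmas generated_fixed_slice =
  generated_slice[OF collection generated_fixed, folded fixed_set_eq]

lemma solve_fixed:
  "solve Q y_coords (\<lambda>v. obj (snd v)) ({0} \<times> fixed_set P x z) (Some (0, y)) \<Longrightarrow>
    y \<in> fixed_set P x z \<and> (\<forall>w\<in>fixed_set P x z. obj y \<le> obj w)"
  "solve Q y_coords (\<lambda>v. obj (snd v)) ({0} \<times> fixed_set P x z) None \<Longrightarrow> fixed_set P x z = {}"
  using convex_solve(1,2)[OF generated_fixed_slice convex_on_obj] by force+

lemma milp_Some:
  assumes "x \<in> X01" "finite \<Lambda>" "milp Q x \<Lambda> (Some (y, M))"
  shows "(x, y) \<in> master P \<Lambda>" "\<And>u. (x, u) \<in> master P \<Lambda> \<Longrightarrow> obj y \<le> obj u"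
    "finite M" "{(x', y') \<in> master P \<Lambda>. x' \<in> zero_one} \<subseteq> satisfies M"
    "is_arg_min (\<lambda>y. obj y) (\<lambda>y. y \<in> lp_set P M x) y"
  using milp[unfolded milp_oracle_def, rule_format, OF assms(1,2), THEN conjunct2, THEN conjunct2,
      rule_format, OF assms(3)]
  by (auto simp: is_arg_min_linorder)

lemma milp_None:
  assumes "x \<in> X01" "finite \<Lambda>" "milp Q x \<Lambda> None"
  shows "(x, u) \<notin> master P \<Lambda>"
  using milp[unfolded milp_oracle_def, rule_format, OF assms(1,2), THEN conjunct2, THEN conjunct1]
    assms(3) by auto

text \<open>Validity is asked on all of \<open>S_set P\<close>, over every \<open>x\<close> and
  without the linear equations or integrality, since the Benders cuts derived later must hold at
  other first-stage points. Finiteness is there because the master oracle is specified for finite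
  cut sets.\<close>

definition valid_cuts where
  "valid_cuts \<Lambda> \<longleftrightarrow> finite \<Lambda> \<and> S_set P \<subseteq> satisfies \<Lambda>"

lemma feasible_imp_master: "valid_cuts \<Lambda> \<Longrightarrow> (x, y) \<in> feasible P \<Longrightarrow> (x, y) \<in> master P \<Lambda>"
  by (auto simp: feasible_iff master_def valid_cuts_def S_set_eq)

lemma fixed_set_feasible:
  "x \<in> X01 \<Longrightarrow> (x, y) \<in> master P \<Lambda> \<Longrightarrow> w \<in> fixed_set P x y \<Longrightarrow> (x, w) \<in> feasible P"
  by (auto simp: feasible_iff mem_fixed_set master_def mixed_int_def)

lemma second_none:
  assumes "x \<in> X01" "valid_cuts \<Lambda>" "second_iter P Q x \<Lambda> NoSolution"
  shows "(x, u) \<notin> feasible P"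
  using assms(3)
proof cases
  case master_infeasible
  then show ?thesis
    using milp_None[of x \<Lambda> u] feasible_imp_master assms(1,2) by (auto simp: valid_cuts_def)
next
  case (S_empty y M)
  then show ?thesis
    using convex_solve(2)[OF generated_S convex_on_dist_right] by (auto simp: feasible_iff)
qed

text \<open>The master problem is a relaxation, so a feasible point attaining its value is optimal.
  The last claim keeps the master solution apart from the returned point because
  \<open>fixed_solves\<close> may return a different point of the same value; duality needs only the
  value.\<close>

lemma second_returned:
  assumes x: "x \<in> X01" and \<Lambda>: "valid_cuts \<Lambda>" and "second_iter P Q x \<Lambda> (Returned y M)"
  shows "(x, y) \<in> feasible P" "\<And>u. (x, u) \<in> feasible P \<Longrightarrow> obj y \<le> obj u"
    "finite M" "feasible P \<subseteq> satisfies M"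
    "\<exists>y0. is_arg_min (\<lambda>y. obj y) (\<lambda>y. y \<in> lp_set P M x) y0 \<and> obj y0 = obj y"
proof -
  obtain y0 where y0: "milp Q x \<Lambda> (Some (y0, M))" "obj y0 = obj y" "(x, y) \<in> feasible P"
    using assms(3)
  proof cases
    case master_solves
    then have "(x, y) \<in> feasible P"
      using milp_Some(1)[OF x _ master_solves(1)] \<Lambda> x
      by (auto simp: valid_cuts_def feasible_iff master_def)
    with master_solves that show ?thesis by blast
  next
    case (fixed_solves y0 p)
    then show ?thesis
      using milp_Some(1)[OF x _ fixed_solves(1)] \<Lambda> x solve_fixed(1) fixed_set_feasible that
      by (metis valid_cuts_def)
  qed
  note m = milp_Some[OF x _ y0(1)]
  have fin: "finite \<Lambda>" using \<Lambda> by (simp add: valid_cuts_def)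
  show "(x, y) \<in> feasible P" by fact
  show "obj y \<le> obj u" if "(x, u) \<in> feasible P" for u
    using m(2)[OF fin feasible_imp_master[OF \<Lambda> that]] y0(2) by simp
  show "finite M" using m(3)[OF fin] .
  show "feasible P \<subseteq> satisfies M"
    using m(4)[OF fin] feasible_imp_master[OF \<Lambda>] by (auto simp: feasible_def)
  show "\<exists>y0. is_arg_min (\<lambda>y. obj y) (\<lambda>y. y \<in> lp_set P M x) y0 \<and> obj y0 = obj y"
    using m(5)[OF fin] y0(2) by blast
qed

lemma valid_cuts_projection:
  assumes "valid_cuts \<Lambda>" "solve Q Basis (\<lambda>v. dist v u) (S_set P) (Some p)"
  shows "valid_cuts (insert (projection_cut u p) \<Lambda>)"
  using assms solve_projection(2)[OF assms(2)]
  by (auto simp: valid_cuts_def mem_satisfies_projection_cut)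

text \<open>The oracle's cone is the true normal cone because \<open>(x, y)\<close> lies in
  \<open>G_set P\<close>, and a normal to that set is valid on its subset
  \<open>S_set P\<close>.\<close>

lemma cut_normal_valid:
  assumes "cut_normal P Q x z y d" "v \<in> S_set P" "(x, y) \<in> S_set P"
  shows "d \<bullet> (v - (x, y)) \<le> 0"
proof -
  have "ncone Q Basis (G_set P) (x, y) = normal_cone Basis (G_set P) (x, y)"
    using oracles generated_G assms(3) by (auto simp: convex_oracles_def S_set_eq)
  then show ?thesis
    using assms by (auto simp: cut_normal_def normal_cone_def S_set_eq)
qed

text \<open>
  In a neighbourhood of an interior point of \<open>S_set P\<close> only the affine constraints of the
  integer-fixed program are active, so a local minimum there is a global one of the program
  without the constraints of \<open>S_set P\<close>.
\<close>

lemma fixed_interior_minimal: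
  assumes y: "y \<in> fixed_set P x z" "\<forall>w\<in>fixed_set P x z. obj y \<le> obj w"
    and interior: "(x, y) \<notin> frontier (S_set P)"
    and u: "(x, u) \<in> lin_eq P" "\<forall>j\<in>intv P. u $ j = z $ j"
  shows "obj y \<le> obj u"
proof (rule ccontr)
  assume less: "\<not> obj y \<le> obj u"
  let ?w = "\<lambda>t. y + t *\<^sub>R (u - y)"
  have "(x, y) \<in> interior (S_set P)"
    using interior y(1) closure_subset by (auto simp: frontier_def mem_fixed_set)
  moreover have "((\<lambda>t. (x, ?w t)) \<longlongrightarrow> (x, ?w 0)) (at_right (0::real))"
    by (intro tendsto_intros)
  ultimately have "\<forall>\<^sub>F t in at_right (0::real). (x, ?w t) \<in> interior (S_set P)"
    by (intro topological_tendstoD) auto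
  then have "\<forall>\<^sub>F t in at_right (0::real). 0 < t \<and> (x, ?w t) \<in> interior (S_set P)"
    by (intro eventually_conj eventually_at_right_less)
  then obtain t :: real where t: "0 < t" "(x, ?w t) \<in> interior (S_set P)"
    using eventually_happens' trivial_limit_at_right_real by blast
  have "mat_W P *v u = mat_W P *v y"
    using u(1) y(1) by (simp add: mem_fixed_set lin_eq_def) (metis add_left_cancel)
  then have "(x, ?w t) \<in> lin_eq P"
    using y(1) by (simp add: mem_fixed_set lin_eq_def matrix_vector_right_distrib
        matrix_vector_mult_diff_distrib matrix_vector_mult_scaleR)
  then have "?w t \<in> fixed_set P x z"
    using t(2) interior_subset u(2) y(1) by (auto simp: mem_fixed_set)
  with y(2) have "obj y \<le> obj (?w t)" by blast
  with t(1) less show False by (auto simp: inner_add_right inner_diff_right zero_le_mult_iff)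
qed

text \<open>The last two facts about \<open>y\<close> oppose each other: every point of the
  integer-fixed program costs more than the current master solution, while a later master point with
  the same integer part costs at least as much as some point of that program. Hence a feasible
  assignment cannot recur.\<close>

lemma second_proceed:
  assumes x: "x \<in> X01" and \<Lambda>: "valid_cuts \<Lambda>" and iter: "second_iter P Q x \<Lambda> (Proceed \<Lambda>')"
  shows "valid_cuts \<Lambda>' \<and> satisfies \<Lambda>' \<subseteq> satisfies \<Lambda> \<and> (\<exists>y p. (x, y) \<in> master P \<Lambda> \<and> p \<in> S_set P \<and>
    (\<forall>v\<in>satisfies \<Lambda>'. ((x, y) - p) \<bullet> (v - p) \<le> 0) \<and>
    (\<forall>w\<in>fixed_set P x y. obj y < obj w) \<and>
    (\<forall>u. fixed_set P x y \<noteq> {} \<and> (x, u) \<in> master P \<Lambda>' \<and> (\<forall>j\<in>intv P. u $ j = y $ j) \<longrightarrow>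
      (\<exists>w\<in>fixed_set P x y. obj w \<le> obj u)))"
    (is "_ \<and> _ \<and> (\<exists>y p. ?progress y p)")
proof -
  have fin: "finite \<Lambda>" using \<Lambda> by (simp add: valid_cuts_def)
  \<comment> \<open>The integer-fixed optimum is feasible for the master problem, so its value is
    not below the master value; equality is the case in which the method returns.\<close>
  have strict: "\<forall>w\<in>fixed_set P x y. obj y < obj w"
    if "milp Q x \<Lambda> (Some (y, M))" "y' \<in> fixed_set P x y" "\<forall>w\<in>fixed_set P x y. obj y' \<le> obj w"
      "obj y' \<noteq> obj y" for y y' M
  proof -
    have "(x, y') \<in> master P \<Lambda>"
      using milp_Some(1)[OF x fin that(1)] that(2) feasible_imp_master[OF \<Lambda>] fixed_set_feasible x
      by blast
    then have "obj y < obj y'" using milp_Some(2)[OF x fin that(1)] that(4) by fastforce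
    with that(3) show ?thesis by force
  qed
  show ?thesis using iter
  proof cases
    case (fixed_infeasible y M p)
    \<comment> \<open>Both cost claims become vacuous here.\<close>
    have "fixed_set P x y = {}" using solve_fixed(2) fixed_infeasible by blast
    then have "?progress y p"
      using fixed_infeasible milp_Some(1)[OF x fin] solve_projection(1)
      by (auto simp: mem_satisfies_projection_cut)
    moreover have "valid_cuts \<Lambda>'" "satisfies \<Lambda>' \<subseteq> satisfies \<Lambda>"
      using valid_cuts_projection[OF \<Lambda>] fixed_infeasible by (auto simp: mem_satisfies_projection_cut)
    ultimately show ?thesis by blast
  next
    case (fixed_boundary y M p y' d)
    note y' = solve_fixed(1)[OF fixed_boundary(5)]
    have S: "(x, y') \<in> S_set P" using y' by (simp add: mem_fixed_set)
    have "obj y' \<le> obj u" if u: "(x, u) \<in> master P \<Lambda>'" "\<forall>j\<in>intv P. u $ j = y $ j" for u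
    proof -
      \<comment> \<open>Both points have first component \<open>x\<close>, so only
        \<open>snd d\<close> acts, the vector for which \<open>cut_normal\<close> keeps the optimal
        value unchanged.\<close>
      have "d \<bullet> ((x, u) - (x, y')) \<le> 0"
        using u(1) fixed_boundary(1) by (auto simp: master_def mem_satisfies_normal_cut)
      then have "snd d \<bullet> (u - y') \<le> 0" by (simp add: inner_prod_def)
      then have "u \<in> {w. (x, w) \<in> lin_eq P \<and> snd d \<bullet> (w - y') \<le> 0 \<and> w \<in> Y_set P \<and>
          (\<forall>j\<in>intv P. w $ j = y $ j)}"
        using u by (simp add: master_def)
      from opt_value_le[OF this, of "\<lambda>y. obj y"] fixed_boundary(8)
      have "opt_value (\<lambda>y. obj y) (fixed_set P x y) \<le> ereal (obj u)"
        unfolding cut_normal_def by argo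
      moreover have "ereal (obj y') \<le> opt_value (\<lambda>y. obj y) (fixed_set P x y)"
        using y' by (intro opt_value_ge) auto
      ultimately have "ereal (obj y') \<le> ereal (obj u)" by (rule order_trans[rotated])
      then show ?thesis by simp
    qed
    then have "?progress y p"
      using fixed_boundary(1) milp_Some(1)[OF x fin fixed_boundary(2)] solve_projection(1)[OF fixed_boundary(4)]
        strict[OF fixed_boundary(2)] y' fixed_boundary(6)
      by (simp add: mem_satisfies_projection_cut mem_satisfies_normal_cut) blast
    moreover have "satisfies \<Lambda>' \<subseteq> satisfies \<Lambda>"
      using fixed_boundary(1) by (auto simp: mem_satisfies_projection_cut mem_satisfies_normal_cut)
    moreover have "valid_cuts \<Lambda>'"
      using valid_cuts_projection[OF \<Lambda> fixed_boundary(4)] cut_normal_valid[OF fixed_boundary(8) _ S]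
      unfolding fixed_boundary(1) by (auto simp: valid_cuts_def mem_satisfies_normal_cut)
    ultimately show ?thesis by blast
  next
    case (fixed_interior y M p y')
    note y' = solve_fixed(1)[OF fixed_interior(5)]
    have "obj y' \<le> obj u" if u: "(x, u) \<in> master P \<Lambda>'" "\<forall>j\<in>intv P. u $ j = y $ j" for u
      using fixed_interior_minimal[of y' x y u] y' fixed_interior(7) u by (auto simp: master_def)
    then have "?progress y p"
      using fixed_interior(1) milp_Some(1)[OF x fin fixed_interior(2)] solve_projection(1)[OF fixed_interior(4)]
        strict[OF fixed_interior(2)] y' fixed_interior(6)
      by (simp add: mem_satisfies_projection_cut) blast
    moreover have "valid_cuts \<Lambda>'" "satisfies \<Lambda>' \<subseteq> satisfies \<Lambda>"
      using valid_cuts_projection[OF \<Lambda> fixed_interior(4)] fixed_interior(1)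
      by (auto simp: mem_satisfies_projection_cut)
    ultimately show ?thesis by blast
  qed
qed

text \<open>
  A cluster point \<open>y\<close> of the master solutions lies in \<open>S_set P\<close>, because the distance of each
  master solution from \<open>S_set P\<close> is at most its distance from any later one. The integer components
  converge, hence are eventually those of \<open>y\<close>, whose integer-fixed program is feasible; but a
  feasible integer assignment never occurs twice.
\<close>

lemma second_terminates:
  assumes x: "x \<in> X01" and "valid_cuts (\<Lambda> 0)"
    and iter: "\<And>k. second_iter P Q x (\<Lambda> k) (Proceed (\<Lambda> (Suc k)))"
  shows False
proof -
  have valid: "valid_cuts (\<Lambda> k)" for k
    by (induction k) (use assms second_proceed in blast)+
  have "\<forall>k. \<exists>y p. (x, y) \<in> master P (\<Lambda> k) \<and> p \<in> S_set P \<and>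
    (\<forall>v\<in>satisfies (\<Lambda> (Suc k)). ((x, y) - p) \<bullet> (v - p) \<le> 0) \<and>
    (\<forall>w\<in>fixed_set P x y. obj y < obj w) \<and>
    (\<forall>u. fixed_set P x y \<noteq> {} \<and> (x, u) \<in> master P (\<Lambda> (Suc k)) \<and> (\<forall>j\<in>intv P. u $ j = y $ j) \<longrightarrow>
      (\<exists>w\<in>fixed_set P x y. obj w \<le> obj u))"
    using second_proceed[OF x valid iter] by blast
  then obtain y p where
    y: "\<And>k. (x, y k) \<in> master P (\<Lambda> k)" and p: "\<And>k. p k \<in> S_set P"
    and cut: "\<And>k v. v \<in> satisfies (\<Lambda> (Suc k)) \<Longrightarrow> ((x, y k) - p k) \<bullet> (v - p k) \<le> 0"
    and strict: "\<And>k w. w \<in> fixed_set P x (y k) \<Longrightarrow> obj (y k) < obj w"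
    and fixed: "\<And>k u. fixed_set P x (y k) \<noteq> {} \<Longrightarrow> (x, u) \<in> master P (\<Lambda> (Suc k)) \<Longrightarrow>
      \<forall>j\<in>intv P. u $ j = y k $ j \<Longrightarrow> \<exists>w\<in>fixed_set P x (y k). obj w \<le> obj u"
    by metis
  have "decseq (\<lambda>k. satisfies (\<Lambda> k))"
    using second_proceed[OF x valid iter] by (intro decseq_SucI) blast
  then have later: "(x, y l) \<in> master P (\<Lambda> (Suc k))" if "k < l" for k l
    using y[of l] decseqD[of "\<lambda>k. satisfies (\<Lambda> k)" "Suc k" l] that by (auto simp: master_def Suc_le_eq)
  have once: "fixed_set P x (y k) = {}" if "k < l" "\<forall>j\<in>intv P. y l $ j = y k $ j" for k l
  proof (rule ccontr)
    assume "fixed_set P x (y k) \<noteq> {}"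
    from fixed[OF this later[OF that(1)] that(2)] obtain w
      where "w \<in> fixed_set P x (y k)" "obj w \<le> obj (y l)" by blast
    \<comment> \<open>\<open>y l\<close> has the integer part of \<open>y k\<close>, so
      \<open>w\<close> also belongs to its integer-fixed program and must cost more than
      \<open>y l\<close>.\<close>
    with strict[of w l] that(2) show False by (simp add: mem_fixed_set)
  qed
  have "compact (Y_set P)"
    using Y_polyhedron Y_bounded by (simp add: compact_eq_bounded_closed polyhedron_imp_closed)
  moreover have "\<forall>k. y k \<in> Y_set P" using y by (auto simp: master_def)
  ultimately obtain ys r where r: "strict_mono r" "(y \<circ> r) \<longlonglongrightarrow> ys"
    unfolding compact_def by metis
  have lim: "(\<lambda>k. (x, y (r k))) \<longlonglongrightarrow> (x, ys)"
    using tendsto_Pair[OF tendsto_const r(2)] by (simp add: o_def)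
  have near: "norm ((x, y k) - p k) \<le> norm (y k - y l)" if "k < l" for k l
  proof -
    let ?d = "(x, y k) - p k"
    have "?d \<bullet> ((x, y l) - p k) \<le> 0"
      using cut later[OF that] by (auto simp: master_def)
    \<comment> \<open>\<open>(x, y l) - p k\<close> is \<open>?d\<close> minus
      \<open>(x, y k) - (x, y l)\<close>; Cauchy-Schwarz and cancelling a factor
      \<open>norm ?d\<close> finish.\<close>
    then have "?d \<bullet> ?d \<le> ?d \<bullet> ((x, y k) - (x, y l))" by (simp only: inner_diff_right)
    also have "\<dots> \<le> norm ?d * norm ((x, y k) - (x, y l))" by (rule norm_cauchy_schwarz)
    finally have "norm ?d * norm ?d \<le> norm ?d * norm (y k - y l)"
      by (simp add: norm_Pair dot_square_norm power2_eq_square)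
    then show ?thesis by (cases "?d = 0") (auto simp: mult_le_cancel_left_pos)
  qed
  \<comment> \<open>Consecutive members of a convergent subsequence approach each other, so the
    residuals vanish and the projections share the limit, which closedness puts into
    \<open>S_set P\<close>.\<close>
  have "(\<lambda>k. norm (y (r k) - y (r (Suc k)))) \<longlonglongrightarrow> norm (ys - ys)"
    using r(2) LIMSEQ_Suc[OF r(2)] by (intro tendsto_norm tendsto_diff) (simp_all add: o_def)
  moreover have "\<forall>\<^sub>F k in sequentially. norm ((x, y (r k)) - p (r k)) \<le> norm (y (r k) - y (r (Suc k)))"
    using near r(1) by (intro always_eventually) (simp add: strict_mono_Suc_iff)
  ultimately have "(\<lambda>k. (x, y (r k)) - p (r k)) \<longlonglongrightarrow> 0"
    using Lim_null_comparison[of "\<lambda>k. (x, y (r k)) - p (r k)"] by simp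
  from tendsto_diff[OF lim this] have "(\<lambda>k. p (r k)) \<longlonglongrightarrow> (x, ys)" by simp
  then have S: "(x, ys) \<in> S_set P"
    using closed_sequentially[OF closed_S, of "\<lambda>k. p (r k)"] p by simp
  have "(x, y (r k)) \<in> lin_eq P" for k using y[of "r k"] by (simp add: master_def)
  with lim have E: "(x, ys) \<in> lin_eq P"
    using closed_sequentially[of "lin_eq P" "\<lambda>k. (x, y (r k))"]
      generated_convex_closed(2)[OF collection generated_lin_eq] by simp
  have "\<forall>\<^sub>F k in sequentially. y (r k) $ j = ys $ j" if "j \<in> intv P" for j
  proof -
    have lim: "(\<lambda>k. y (r k) $ j) \<longlonglongrightarrow> ys $ j"
      using tendsto_vec_nth[OF r(2)] by (simp add: o_def)
    have int: "y k $ j \<in> \<int>" for k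
      using y[of k] that by (auto simp: master_def mixed_int_def)
    with lim have "ys $ j \<in> \<int>"
      using closed_sequentially[OF closed_Ints, of "\<lambda>k. y (r k) $ j"] by simp
    moreover have "\<forall>\<^sub>F k in sequentially. dist (y (r k) $ j) (ys $ j) < 1"
      using lim by (rule tendstoD) simp
    ultimately show ?thesis
      using int by (simp add: Ints_eq_abs_less1 dist_real_def)
  qed
  then have "\<forall>\<^sub>F k in sequentially. \<forall>j\<in>intv P. y (r k) $ j = ys $ j"
    by (intro eventually_ball_finite) auto
  then obtain K where K: "\<And>k. K \<le> k \<Longrightarrow> \<forall>j\<in>intv P. y (r k) $ j = ys $ j"
    by (auto simp: eventually_sequentially)
  have "ys \<in> fixed_set P x (y (r K))" using S E K[of K] by (simp add: mem_fixed_set)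
  moreover have "fixed_set P x (y (r K)) = {}"
    using once[of "r K" "r (Suc K)"] K[of K] K[of "Suc K"] r(1) by (simp add: strict_mono_Suc_iff)
  ultimately show False by blast
qed

section \<open>Every second-stage iteration can be carried out\<close>

lemma second_progress:
  assumes x: "x \<in> X01" and \<Lambda>: "valid_cuts \<Lambda>" and cn: "cut_normals_exist P Q"
  shows "\<exists>r. second_iter P Q x \<Lambda> r"
proof -
  have fin: "finite \<Lambda>" using \<Lambda> by (simp add: valid_cuts_def)
  obtain a where a: "milp Q x \<Lambda> a"
    using milp x fin unfolding milp_oracle_def by blast
  show ?thesis
  proof (cases a)
    case None
    then show ?thesis using a second_iter.master_infeasible by blast
  next
    case (Some yM)
    then obtain y M where yM: "milp Q x \<Lambda> (Some (y, M))" using a by (cases yM) auto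
    have y: "y \<in> mixed_int P" using milp_Some(1)[OF x fin yM] by (simp add: master_def)
    show ?thesis
    proof (cases "(x, y) \<in> S_set P")
      case True
      then show ?thesis using yM second_iter.master_solves by blast
    next
      case notS: False
      \<comment> \<open>Closedness suffices for a nearest point, although \<open>S_set P\<close> may
        be unbounded in \<open>x\<close>.\<close>
      have "S_set P = {} \<or> (\<exists>v\<in>S_set P. \<forall>w\<in>S_set P. dist v (x, y) \<le> dist w (x, y))"
        using distance_attains_inf[OF closed_S, of "(x, y)"] by (metis dist_commute)
      from convex_solve(3)[OF generated_S convex_on_dist_right this]
      obtain b where b: "solve Q Basis (\<lambda>v. dist v (x, y)) (S_set P) b" by blast
      show ?thesis
      proof (cases b)
        case None
        then show ?thesis using b notS yM second_iter.S_empty by blast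
      next
        case (Some p)
        let ?A = "{0} \<times> fixed_set P x y"
        have "fixed_set P x y = {} \<or> (\<exists>v\<in>fixed_set P x y. \<forall>w\<in>fixed_set P x y. obj v \<le> obj w)"
          using continuous_attains_inf[OF compact_fixed_set, of x y "\<lambda>y. obj y"]
            continuous_on_inner[OF continuous_on_const continuous_on_id] by blast
        then have "?A = {} \<or> (\<exists>v\<in>?A. \<forall>w\<in>?A. obj (snd v) \<le> obj (snd w))" by auto
        from convex_solve(3)[OF generated_fixed_slice convex_on_obj this]
        obtain c where c: "solve Q y_coords (\<lambda>v. obj (snd v)) ?A c" by blast
        show ?thesis
        proof (cases c)
          case None
          then show ?thesis using b c Some notS yM second_iter.fixed_infeasible by blast
        next
          case (Some v)
          then have "v \<in> ?A"
            using convex_solve(1)[OF generated_fixed_slice convex_on_obj] c by blast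
          then obtain y' where "v = (0, y')" by auto
          with c Some have c': "solve Q y_coords (\<lambda>v. obj (snd v)) ?A (Some (0, y'))" by simp
          from solve_fixed(1)[OF this]
          have "is_arg_min (\<lambda>y. obj y) (\<lambda>w. w \<in> fixed_set P x y) y'"
            by (simp add: is_arg_min_linorder)
          then have "(x, y') \<in> frontier (S_set P) \<Longrightarrow> \<exists>d. cut_normal P Q x y y' d"
            using cn x y unfolding cut_normals_exist_def by blast
          then show ?thesis
            using b \<open>b = Some p\<close> c' notS yM second_iter.fixed_solves second_iter.fixed_boundary
              second_iter.fixed_interior by metis
        qed
      qed
    qed
  qed
qed


section \<open>The decomposition algorithm\<close>

abbreviation cost where "cost x y \<equiv> cost_x P \<bullet> x + obj y"

definition valid_relaxation where
  "valid_relaxation B N \<longleftrightarrow> finite B \<and> (\<forall>(a, b)\<in>B. \<forall>(x, y)\<in>feasible P. a \<bullet> x + b \<le> obj y) \<and>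
     N \<subseteq> zero_one \<and> (\<forall>x\<in>N. \<forall>y. (x, y) \<notin> feasible P)"

text \<open>Excluding \<infinity> ensures that the loop cannot end right after an infeasible visit,
  where \<open>U\<close> is \<infinity> and no pair is stored.\<close>

definition lower_bound where
  "lower_bound L \<longleftrightarrow> L \<noteq> \<infinity> \<and> (\<forall>(x, y)\<in>feasible P. L \<le> ereal (cost x y))"

text \<open>In a \<open>Second\<close> state, the bound of the Benders cuts at \<open>x\<close> by
  \<open>L\<close> is what forces \<open>U \<le> L\<close> if \<open>x\<close> turns out to be
  tight, and \<open>x \<notin> N\<close> makes excluding \<open>x\<close> count as progress.\<close>

fun invariant :: "('m, 'n) state \<Rightarrow> bool" where
  "invariant (Loop L U B N s) \<longleftrightarrow> valid_relaxation B N \<and> lower_bound L \<and>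
     (case s of None \<Rightarrow> U = \<infinity> | Some (x, y) \<Rightarrow> (x, y) \<in> feasible P \<and> U = ereal (cost x y))"
| "invariant (Second L B N x \<Lambda>) \<longleftrightarrow> valid_relaxation B N \<and> lower_bound L \<and> x \<in> X01 \<and> x \<notin> N \<and>
     (\<forall>(a, b)\<in>B. ereal (cost_x P \<bullet> x + (a \<bullet> x + b)) \<le> L) \<and> valid_cuts \<Lambda>"
| "invariant (Halt Infeasible) \<longleftrightarrow> feasible P = {}"
| "invariant (Halt (Solution x y)) \<longleftrightarrow> jmicp_optimal P (x, y)"

text \<open>The first-stage problem is a relaxation, which makes its value a lower bound and its
  infeasibility a proof of infeasibility.\<close>

lemma feasible_in_first_stage:
  assumes "valid_relaxation B N" "(x, y) \<in> feasible P"
  shows "(x, obj y) \<in> first_stage P B N"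
proof -
  have "x \<in> feasibility_cut x0" if "x0 \<in> N" for x0
  proof -
    have "x0 \<in> zero_one" "x \<in> zero_one"
      using assms that by (auto simp: valid_relaxation_def feasible_def)
    moreover have "x \<noteq> x0"
      using assms that unfolding valid_relaxation_def by blast
    ultimately show ?thesis by (simp add: mem_feasibility_cut_iff)
  qed
  moreover have "a \<bullet> x + b \<le> obj y" if "(a, b) \<in> B" for a b
    using assms that unfolding valid_relaxation_def by blast
  ultimately show ?thesis
    using assms(2) by (auto simp: first_stage_def feasible_iff)
qed

lemma first_stage_value_lower_bound:
  assumes "valid_relaxation B N" "v \<in> first_stage P B N"
  shows "lower_bound (first_stage_value P B N)"
proof -
  have "first_stage_value P B N \<noteq> \<infinity>"
    using opt_value_le[OF assms(2), of "\<lambda>(x, \<eta>). cost_x P \<bullet> x + \<eta>"]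
    by (auto simp: first_stage_value_def)
  moreover have "first_stage_value P B N \<le> ereal (cost x y)" if "(x, y) \<in> feasible P" for x y
    using opt_value_le[OF feasible_in_first_stage[OF assms(1) that], of "\<lambda>(x, \<eta>). cost_x P \<bullet> x + \<eta>"]
    by (simp add: first_stage_value_def)
  ultimately show ?thesis by (auto simp: lower_bound_def)
qed

lemma first_stage_solution_ge:
  assumes "first_stage_solution P B N x" "(a, b) \<in> B"
  shows "ereal (cost_x P \<bullet> x + (a \<bullet> x + b)) \<le> first_stage_value P B N"
proof -
  have "a \<bullet> x + b \<le> \<eta>" if "(x, \<eta>) \<in> first_stage P B N" for \<eta>
    using that assms(2) by (auto simp: first_stage_def)
  then have "ereal (cost_x P \<bullet> x + (a \<bullet> x + b))
      \<le> opt_value (\<lambda>\<eta>. cost_x P \<bullet> x + \<eta>) {\<eta>. (x, \<eta>) \<in> first_stage P B N}"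
    by (intro opt_value_ge) simp
  with assms(1) show ?thesis by (simp add: first_stage_solution_def)
qed

text \<open>Minimising over \<open>\<eta>\<close> for each \<open>x\<close> leaves finitely many
  extended real values, so a least one exists even when it is \<open>-\<infinity>\<close>, the case
  without Benders cuts.\<close>

lemma first_stage_solution_exists:
  assumes "first_stage P B N \<noteq> {}"
  shows "\<exists>x. first_stage_solution P B N x"
proof -
  define f where "f x = opt_value (\<lambda>\<eta>. cost_x P \<bullet> x + \<eta>) {\<eta>. (x, \<eta>) \<in> first_stage P B N}" for x
  let ?A = "fst ` first_stage P B N"
  have "finite ?A"
    by (rule finite_subset[OF _ finite_zero_one]) (auto simp: first_stage_def)
  then have "Min (f ` ?A) \<in> f ` ?A" "\<forall>x\<in>?A. Min (f ` ?A) \<le> f x" using assms by auto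
  then obtain x where x: "x \<in> ?A" "\<And>x'. x' \<in> ?A \<Longrightarrow> f x \<le> f x'" by force
  have "f x = first_stage_value P B N"
  proof (rule antisym)
    show "f x \<le> first_stage_value P B N"
      unfolding first_stage_value_def
    proof (rule opt_value_ge, clarify)
      fix x' \<eta> assume fs: "(x', \<eta>) \<in> first_stage P B N"
      then have "f x \<le> f x'" by (force intro: x(2))
      also have "f x' \<le> ereal (cost_x P \<bullet> x' + \<eta>)"
        unfolding f_def by (rule opt_value_le) (simp add: fs)
      finally show "f x \<le> ereal (cost_x P \<bullet> x' + \<eta>)" .
    qed
    show "first_stage_value P B N \<le> f x"
      unfolding f_def first_stage_value_def
      by (rule opt_value_ge) (use opt_value_le[of _ "first_stage P B N" "\<lambda>(x, \<eta>). cost_x P \<bullet> x + \<eta>"] in fastforce)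
  qed
  then show ?thesis using x(1) by (auto simp: first_stage_solution_def f_def)
qed

lemma benders_cut_valid:
  assumes "feasible P \<subseteq> satisfies M" "dual_feasible P M \<mu> lam" "(x, y) \<in> feasible P"
    and "benders_cut P M \<mu> lam = (a, b)"
  shows "a \<bullet> x + b \<le> obj y"
proof -
  have "y \<in> lp_set P M x" using assms(1,3) by (auto simp: lp_set_def feasible_iff)
  from dual_value_le[OF assms(2) this] show ?thesis
    using benders_cut_value[of P M \<mu> lam x] assms(4) by simp
qed

lemma benders_cut_tight:
  assumes "x \<in> X01" "valid_cuts \<Lambda>" "second_iter P Q x \<Lambda> (Returned y M)"
    and "dual_optimal P M x (\<mu>, lam)" "benders_cut P M \<mu> lam = (a, b)"
  shows "obj y \<le> a \<bullet> x + b"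
proof -
  note second_returned[OF assms(1-3)]
  then show ?thesis
    using dual_optimal_value[of M P x _ \<mu> lam] assms(4) benders_cut_value[of P M \<mu> lam x] assms(5)
    by force
qed

lemma valid_relaxation_insert:
  assumes "valid_relaxation B N" "x \<in> X01" "valid_cuts \<Lambda>"
    and "second_iter P Q x \<Lambda> (Returned y M)" "dual_optimal P M x (\<mu>, lam)"
  shows "valid_relaxation (insert (benders_cut P M \<mu> lam) B) N"
proof (cases "benders_cut P M \<mu> lam")
  case (Pair a b)
  have "dual_feasible P M \<mu> lam" using assms(5) by (simp add: dual_optimal_iff)
  from benders_cut_valid[OF second_returned(4)[OF assms(2-4)] this _ Pair] assms(1)
  show ?thesis by (auto simp: valid_relaxation_def Pair)
qed

lemma jmicp_optimal_iff:
  "jmicp_optimal P (x, y) \<longleftrightarrow> (x, y) \<in> feasible P \<and> (\<forall>(x', y')\<in>feasible P. cost x y \<le> cost x' y')"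
  by (auto simp: jmicp_optimal_def is_arg_min_linorder)

lemma valid_cuts_empty: "valid_cuts {}"
  by (auto simp: valid_cuts_def satisfies_def)

lemma invariant_step:
  assumes "step P Q s t" "invariant s"
  shows "invariant t"
  using assms(1)
proof cases
  case (loop_end L U B N x y)
  have "cost x y \<le> cost x' y'" if "(x', y') \<in> feasible P" for x' y'
  proof -
    have "ereal (cost x y) \<le> L" using loop_end assms(2) by (auto simp: not_less)
    also have "L \<le> ereal (cost x' y')" using loop_end assms(2) that by (auto simp: lower_bound_def)
    finally show ?thesis by simp
  qed
  then show ?thesis using loop_end assms(2) by (auto simp: jmicp_optimal_iff)
next
  case (first_infeasible L U B N s)
  then show ?thesis using assms(2) feasible_in_first_stage[of B N] by fastforce
next
  case (first_solved L U B N x s)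
  then obtain \<eta> where "(x, \<eta>) \<in> first_stage P B N" by (auto simp: first_stage_solution_def)
  moreover have rel: "valid_relaxation B N" using first_solved assms(2) by simp
  moreover have "x \<notin> N"
  proof
    assume "x \<in> N"
    with calculation have "x \<in> feasibility_cut x" "x \<in> zero_one" by (auto simp: first_stage_def)
    then show False using mem_feasibility_cut_iff by blast
  qed
  ultimately show ?thesis
    using first_stage_value_lower_bound first_stage_solution_ge[OF first_solved(4)] valid_cuts_empty
    by (auto simp: first_solved(2) first_stage_def)
next
  case (second_proceeds x \<Lambda> \<Lambda>' L B N)
  then show ?thesis using assms(2) second_proceed[of x \<Lambda> \<Lambda>'] by simp
next
  case (second_solved x \<Lambda> y M \<mu> lam L B N)
  then show ?thesis
    using assms(2) valid_relaxation_insert second_returned(1) by auto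
next
  case (second_infeasible x \<Lambda> L B N)
  then show ?thesis
    using assms(2) second_none[of x \<Lambda>] by (auto simp: valid_relaxation_def)
qed

lemma invariant_start: "invariant start"
  by (simp add: start_def valid_relaxation_def lower_bound_def)

lemma invariant_reachable: "(step P Q)\<^sup>*\<^sup>* start s \<Longrightarrow> invariant s"
  by (induction rule: rtranclp_induct) (auto intro: invariant_start invariant_step)

text \<open>Combined with the validity of the cuts, the witness \<open>y\<close> is optimal for the
  second stage at \<open>x\<close>, and \<open>a \<bullet> x + b\<close> is the exact second-stage
  value there.\<close>

definition tight where
  "tight B x \<longleftrightarrow> (\<exists>(a, b)\<in>B. \<exists>y. (x, y) \<in> feasible P \<and> obj y \<le> a \<bullet> x + b)"

definition remaining where
  "remaining B N = {x \<in> X01. x \<notin> N \<and> \<not> tight B x}"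

lemma finite_remaining: "finite (remaining B N)"
  by (rule finite_subset[OF _ finite_zero_one]) (auto simp: remaining_def)

text \<open>
  Each first-stage point is either excluded or made tight when it is visited; visiting a tight
  point forces \<open>U \<le> L\<close>.
\<close>

fun rank :: "('m, 'n) state \<Rightarrow> nat" where
  "rank (Loop L U B N s) = (if L < U then 2 * card (remaining B N) + 3 else 1)"
| "rank (Second L B N x \<Lambda>) = 2 * card (remaining B N) + 2"
| "rank (Halt r) = 0"

text \<open>An outer iteration passes through the \<open>Second\<close> phase, hence the factor 2;
  the offsets order \<open>Halt\<close> (0), a finished loop (1), \<open>Second\<close> (at least 2)
  and an open loop (at least 3). Losing one of \<open>k\<close> remaining points takes
  \<open>2 * k + 2\<close> to at most \<open>2 * k + 1\<close>.\<close>

lemma step_rank: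
  assumes "step P Q s t" "invariant s"
  shows "rank t < rank s \<or> (\<exists>L B N x \<Lambda> \<Lambda>'. s = Second L B N x \<Lambda> \<and> t = Second L B N x \<Lambda>' \<and>
    second_iter P Q x \<Lambda> (Proceed \<Lambda>'))"
  using assms(1)
proof cases
  case (second_solved x \<Lambda> y M \<mu> lam L B N)
  then have x: "x \<in> X01" and \<Lambda>: "valid_cuts \<Lambda>" using assms(2) by auto
  note ret = second_returned[OF x \<Lambda> second_solved(3)]
  let ?B = "insert (benders_cut P M \<mu> lam) B"
  show ?thesis
  proof (cases "tight B x")
    case True
    then obtain a b y' where *: "(a, b) \<in> B" "(x, y') \<in> feasible P" "obj y' \<le> a \<bullet> x + b"
      by (auto simp: tight_def)
    have "ereal (cost x y) \<le> ereal (cost_x P \<bullet> x + (a \<bullet> x + b))"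
      using ret(2)[OF *(2)] *(3) by simp
    also have "\<dots> \<le> L" using assms(2) *(1) by (auto simp: second_solved(1))
    finally have "\<not> L < ereal (cost x y)" by simp
    then show ?thesis by (simp add: second_solved(1,2))
  next
    case False
    then have "x \<in> remaining B N" using x assms(2) by (auto simp: remaining_def second_solved(1))
    moreover have "tight ?B x"
      using benders_cut_tight[OF x \<Lambda> second_solved(3,4)] ret(1)
      by (cases "benders_cut P M \<mu> lam") (auto simp: tight_def)
    moreover have "remaining ?B N \<subseteq> remaining B N"
      by (auto simp: remaining_def tight_def)
    ultimately have "remaining ?B N \<subset> remaining B N" by (auto simp: remaining_def)
    from psubset_card_mono[OF finite_remaining this] show ?thesis
      by (simp add: second_solved(1,2))
  qed
next
  case (second_infeasible x \<Lambda> L B N)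
  then have x: "x \<in> X01" and \<Lambda>: "valid_cuts \<Lambda>" using assms(2) by auto
  have "\<not> tight B x" using second_none[OF x \<Lambda> second_infeasible(3)] by (auto simp: tight_def)
  then have "x \<in> remaining B N" using x assms(2) by (auto simp: remaining_def second_infeasible(1))
  then have "remaining B (insert x N) \<subset> remaining B N" by (auto simp: remaining_def)
  from psubset_card_mono[OF finite_remaining this] show ?thesis
    by (simp add: second_infeasible(1,2))
qed auto

text \<open>The rank never increases, so it is constant from some index \<open>K\<close> on. All
  steps from there are \<open>Proceed\<close> steps of a single second-stage call, which cannot go
  on forever.\<close>

lemma no_infinite_run:
  assumes "s 0 = start" and steps: "\<And>k :: nat. step P Q (s k) (s (Suc k))"
  shows False
proof -
  have inv: "invariant (s k)" for k
    by (induction k) (use assms invariant_start invariant_step in \<open>auto\<close>)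
  obtain K where "\<And>k. rank (s K) \<le> rank (s k)"
    using ex_has_least_nat[of "\<lambda>_. True" _ "\<lambda>k. rank (s k)"] by auto
  moreover have mono: "rank (s (Suc k)) \<le> rank (s k)" for k
    using step_rank[OF steps inv, of k] by auto
  then have "rank (s (K + k)) \<le> rank (s K)" for k
    by (induction k) (use order_trans in auto)
  ultimately have const: "\<not> rank (s (Suc (K + k))) < rank (s (K + k))" for k
    by (metis leD le_trans)
  have proceeds: "\<exists>L B N x \<Lambda> \<Lambda>'. s (K + k) = Second L B N x \<Lambda> \<and> s (Suc (K + k)) = Second L B N x \<Lambda>' \<and>
    second_iter P Q x \<Lambda> (Proceed \<Lambda>')" for k
    using step_rank[OF steps inv] const by blast
  obtain L B N x \<Lambda>0 where K: "s K = Second L B N x \<Lambda>0" using proceeds[of 0] by auto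
  have "\<exists>\<Lambda>. s (K + k) = Second L B N x \<Lambda>" for k
  proof (induction k)
    case (Suc k)
    with proceeds[of k] show ?case by auto
  qed (simp add: K)
  then obtain \<Lambda> where \<Lambda>: "\<And>k. s (K + k) = Second L B N x (\<Lambda> k)" by metis
  have "second_iter P Q x (\<Lambda> k) (Proceed (\<Lambda> (Suc k)))" for k
    using proceeds[of k] \<Lambda>[of k] \<Lambda>[of "Suc k"] by auto
  moreover have "x \<in> X01" "valid_cuts (\<Lambda> 0)" using inv[of K] \<Lambda>[of 0] by auto
  ultimately show False using second_terminates by blast
qed

lemma progress:
  assumes "invariant s" "cut_normals_exist P Q" "\<not> (\<exists>t. step P Q s t)"
  shows "\<exists>r. s = Halt r"
proof (cases s)
  case (Loop L U B N r)
  have "\<exists>t. step P Q s t"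
  proof (cases "L < U")
    case True
    then show ?thesis
      using first_stage_solution_exists step.first_infeasible step.first_solved unfolding Loop by metis
  next
    case False
    \<comment> \<open>\<open>L\<close> is never \<infinity>, so the failed test rules out
      \<open>U = \<infinity>\<close>, and the invariant then supplies a stored pair.\<close>
    then obtain x y where "r = Some (x, y)"
      using assms(1) Loop by (cases r) (auto simp: lower_bound_def less_top[symmetric] top_ereal_def)
    then show ?thesis using False step.loop_end unfolding Loop by blast
  qed
  with assms(3) show ?thesis by blast
next
  case (Second L B N x \<Lambda>)
  then have x: "x \<in> X01" and \<Lambda>: "valid_cuts \<Lambda>" using assms(1) by auto
  obtain r where r: "second_iter P Q x \<Lambda> r" using second_progress[OF x \<Lambda> assms(2)] ..
  have "\<exists>t. step P Q s t"
  proof (cases r)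
    case (Proceed \<Lambda>')
    then show ?thesis using r step.second_proceeds unfolding Second by blast
  next
    case (Returned y M)
    then obtain \<mu> lam where "dual_optimal P M x (\<mu>, lam)"
      using second_returned(3,5)[OF x \<Lambda>] r dual_optimal_exists by blast
    then show ?thesis using r Returned step.second_solved unfolding Second by blast
  next
    case NoSolution
    then show ?thesis using r step.second_infeasible unfolding Second by blast
  qed
  with assms(3) show ?thesis by blast
qed blast

end

text \<open>Oracle answers are nondeterministic, so the claims range over all runs. The first and
  last conjuncts together yield a verdict after finitely many steps.\<close>

theorem theorem3p2:
  fixes P :: "('m :: finite, 'n :: finite, 'r :: finite, 'i) jmicp"
    and F :: "(((real ^ 'm) \<times> (real ^ 'n)) set \<times> ((real ^ 'm) \<times> (real ^ 'n) \<Rightarrow> real)) set"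
    and Q :: "('m, 'n) oracles"
  assumes "polyhedron (X_set P)" "bounded (X_set P)"
    and "polyhedron (Y_set P)" "bounded (Y_set P)"
    and "finite (idx P)"
    and "\<forall>i\<in>idx P. convex_on UNIV (gfun P i)"
    and subdifferential_product:
      "\<forall>i\<in>idx P. \<forall>x0 y0. subdifferential (gfun P i) (x0, y0) =
         subdifferential (\<lambda>x. gfun P i (x, y0)) x0 \<times> subdifferential (\<lambda>y. gfun P i (x0, y)) y0"
    and relative_interior:
      "\<forall>x \<in> X_set P \<inter> zero_one. \<forall>z \<in> mixed_int P.
         fixed_set P x z = {} \<or> rel_interior (fixed_set P x z) \<noteq> {}"
    and collection: "convex_collection F"
      "\<forall>i\<in>idx P. (Basis, gfun P i) \<in> F" "\<forall>a b. (Basis, \<lambda>v. a \<bullet> v - b) \<in> F"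
    and convex_oracles: "convex_oracles F Q"
    and milp_oracle: "milp_oracle P Q"
  shows
    "\<not> (\<exists>s. s 0 = start \<and> (\<forall>k :: nat. step P Q (s k) (s (Suc k)))) \<and>
     (\<forall>x y. (step P Q)\<^sup>*\<^sup>* start (Halt (Solution x y)) \<longrightarrow> jmicp_optimal P (x, y)) \<and>
     ((step P Q)\<^sup>*\<^sup>* start (Halt Infeasible) \<longrightarrow> feasible P = {}) \<and>
     (cut_normals_exist P Q \<longrightarrow>
        (\<forall>s. (step P Q)\<^sup>*\<^sup>* start s \<and> \<not> (\<exists>s'. step P Q s s') \<longrightarrow> (\<exists>r. s = Halt r)))"
proof -
  interpret jmicp_setting P F Q
    using assms by unfold_locales auto
  show ?thesis
    using no_infinite_run invariant_reachable progress
    by (metis invariant.simps(3,4))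
qed

end
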